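(* Let $k$ be a variable part of the input, and let a $k$-hypergraph $(V,\mathcal{H})$ with $n=|V|$, $1\le k<n$, be given by a list of its $m=|\mathcal{H}|$ edges. Then it can be checked in time polynomial in $m$ (which may be much smaller than $\binom{n}{k}$) whether $(V,\mathcal{H})$ is exchangeable, by checking for each of the $O(m^2)$ pairs of edges $E_1,E_2\in\mathcal{H}$ and each of the $O(k^2)$ choices of vertices $v_1\in E_1\setminus E_2$ and $v_2\in E_2\setminus E_1$ whether or not $(E_1\setminus\{v_1\})\cup\{v_2\}$ and $(E_2\setminus\{v_2\})\cup\{v_1\}$ are both in $\overline{\mathcal{H}}$. Since a $k$-hypergraph is $2$-monotone if and only if it is not exchangeable, this procedure is also a polynomial time algorithm for deciding $2$-monotonicity. Consequently, if $(V,\mathcal{H})$ belongs to a class of hypergraphs in which a $k$-hypergraph is equatable if and only if it is exchangeable, then it can be decided in polynomial time, even for variable $k$, by checking exchangeability, whether $(V,\mathcal{H})$ is equatable, and hence whether it is separable.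
   Context: A $k$-hypergraph is a pair $(V,\mathcal{H})$ with $V$ a finite set and $\mathcal{H}\subseteq\binom{V}{k}$ a set of $k$-element subsets of $V$ (the edges); $\overline{\mathcal{H}}:=\binom{V}{k}\setminus\mathcal{H}$. Separable: there is a labeling $x:V\to\mathbb{R}$ such that, with $x(E):=\sum_{v\in E}x(v)$, $\mathcal{H}=\{E\subseteq V:|E|=k,\ x(E)\ge 0\}$. Equatable: there is a labeling $y:\binom{V}{k}\to\mathbb{R}_{\ge 0}$, not identically zero, such that for every $v\in V$, $\sum\{y(E):v\in E\in\mathcal{H}\}=\sum\{y(F):v\in F\in\overline{\mathcal{H}}\}$. Every $k$-hypergraph is either separable or equatable but not both. Exchangeable: there are $E_1,E_2\in\mathcal{H}$, $v_1\in E_1\setminus E_2$ and $v_2\in E_2\setminus E_1$ such that $(E_1\setminus\{v_1\})\cup\{v_2\}\in\overline{\mathcal{H}}$ and $(E_2\setminus\{v_2\})\cup\{v_1\}\in\overline{\mathcal{H}}$. $2$-monotone: for $R_1,R_2\subseteq V$ with $|R_1|=|R_2|$, write $R_1\le R_2$ if for all $S\subseteq V\setminus(R_1\cup R_2)$, $S\cup R_1\in\mathcal{H}$ implies $S\cup R_2\in\mathcal{H}$. The hypergraph is $2$-monotone if for all $R_1,R_2\subseteq V$ with $|R_1|=|R_2|$ and $|R_1\cup R_2|\le 2$, either $R_1\le R_2$ or $R_2\le R_1$.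
   Formalization: "Time polynomial in m" is proved as a polynomial in m times a polynomial in k times the bit length of the largest vertex name (and as polynomial in the input size), since for m = 2 and unbounded k the edges must still be read. *)

theory Defs
  imports
    "HOL-Library.Ramsey"
    "HOL-Library.Log_Nat"
    "HOL-Computational_Algebra.Polynomial"
begin

section \<open>Hypergraphs\<close>

text \<open>The library's \<^term>\<open>nsets V k\<close> is the set of all \<^term>\<open>k\<close>-element subsets of \<^term>\<open>V\<close>.\<close>

definition hypergraph :: "nat \<Rightarrow> 'a set \<Rightarrow> 'a set set \<Rightarrow> bool" where
  "hypergraph k V H \<longleftrightarrow> finite V \<and> H \<subseteq> nsets V k"

definition non_edges :: "nat \<Rightarrow> 'a set \<Rightarrow> 'a set set \<Rightarrow> 'a set set" where
  "non_edges k V H = nsets V k - H"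

definition separable :: "nat \<Rightarrow> 'a set \<Rightarrow> 'a set set \<Rightarrow> bool" where
  "separable k V H \<longleftrightarrow>
    (\<exists>x :: 'a \<Rightarrow> real. H = {E. E \<subseteq> V \<and> card E = k \<and> (\<Sum>v\<in>E. x v) \<ge> 0})"

definition equatable :: "nat \<Rightarrow> 'a set \<Rightarrow> 'a set set \<Rightarrow> bool" where
  "equatable k V H \<longleftrightarrow>
    (\<exists>y :: 'a set \<Rightarrow> real.
      (\<forall>E \<in> nsets V k. y E \<ge> 0) \<and>
      (\<exists>E \<in> nsets V k. y E \<noteq> 0) \<and>
      (\<forall>v \<in> V. (\<Sum>E \<in> {E \<in> H. v \<in> E}. y E) = (\<Sum>F \<in> {F \<in> non_edges k V H. v \<in> F}. y F)))"

definition exchangeable :: "nat \<Rightarrow> 'a set \<Rightarrow> 'a set set \<Rightarrow> bool" where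
  "exchangeable k V H \<longleftrightarrow>
    (\<exists>E1 \<in> H. \<exists>E2 \<in> H. \<exists>v1 \<in> E1 - E2. \<exists>v2 \<in> E2 - E1.
      (E1 - {v1}) \<union> {v2} \<in> non_edges k V H \<and>
      (E2 - {v2}) \<union> {v1} \<in> non_edges k V H)"

definition dominated :: "'a set \<Rightarrow> 'a set set \<Rightarrow> 'a set \<Rightarrow> 'a set \<Rightarrow> bool" where
  "dominated V H R1 R2 \<longleftrightarrow>
    (\<forall>S. S \<subseteq> V - (R1 \<union> R2) \<longrightarrow> S \<union> R1 \<in> H \<longrightarrow> S \<union> R2 \<in> H)"

definition two_monotone :: "'a set \<Rightarrow> 'a set set \<Rightarrow> bool" where
  "two_monotone V H \<longleftrightarrow>
    (\<forall>R1 R2. R1 \<subseteq> V \<longrightarrow> R2 \<subseteq> V \<longrightarrow> card R1 = card R2 \<longrightarrow> card (R1 \<union> R2) \<le> 2 \<longrightarrow>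
      dominated V H R1 R2 \<or> dominated V H R2 R1)"


section \<open>Model of computation\<close>

text \<open>
  Jones's WHILE language (N. D. Jones, Computability and Complexity from a Programming
  Perspective, 1997) with its unit-cost time measure.  Data are binary trees without labels,
  and the only test is whether a tree is the leaf.  Every elementary operation takes constant
  time on a pointer representation with sharing, and polynomial time in this model coincides
  with polynomial time on Turing machines.
\<close>

datatype data = Nl | Cn data data

fun hd_data :: "data \<Rightarrow> data" where
  "hd_data Nl = Nl"
| "hd_data (Cn a b) = a"

fun tl_data :: "data \<Rightarrow> data" where
  "tl_data Nl = Nl"
| "tl_data (Cn a b) = b"

type_synonym vname = string
type_synonym state = "vname \<Rightarrow> data"

datatype exp = Leaf | V vname | Pair exp exp | Hd exp | Tl exp

fun val :: "exp \<Rightarrow> state \<Rightarrow> data" where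
  "val Leaf s = Nl"
| "val (V x) s = s x"
| "val (Pair e f) s = Cn (val e s) (val f s)"
| "val (Hd e) s = hd_data (val e s)"
| "val (Tl e) s = tl_data (val e s)"

fun cost :: "exp \<Rightarrow> nat" where
  "cost Leaf = 1"
| "cost (V x) = 1"
| "cost (Pair e f) = 1 + cost e + cost f"
| "cost (Hd e) = 1 + cost e"
| "cost (Tl e) = 1 + cost e"

datatype com =
    SKIP
  | Assign vname exp    (\<open>_ ::= _\<close> [1000, 61] 61)
  | Seq com com         (\<open>_;;/ _\<close> [60, 61] 60)
  | If exp com com      (\<open>(IF _/ THEN _/ ELSE _)\<close> [0, 0, 61] 61)
  | While exp com       (\<open>(WHILE _/ DO _)\<close> [0, 61] 61)

inductive big_step :: "com \<Rightarrow> state \<Rightarrow> nat \<Rightarrow> state \<Rightarrow> bool" where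
  skip: "big_step SKIP s 1 s"
| assign: "big_step (x ::= e) s (1 + cost e) (s(x := val e s))"
| seq: "big_step c1 s1 t1 s2 \<Longrightarrow> big_step c2 s2 t2 s3 \<Longrightarrow>
    big_step (c1;; c2) s1 (1 + t1 + t2) s3"
| if_true: "val e s \<noteq> Nl \<Longrightarrow> big_step c1 s t s' \<Longrightarrow>
    big_step (IF e THEN c1 ELSE c2) s (1 + cost e + t) s'"
| if_false: "val e s = Nl \<Longrightarrow> big_step c2 s t s' \<Longrightarrow>
    big_step (IF e THEN c1 ELSE c2) s (1 + cost e + t) s'"
| while_false: "val e s = Nl \<Longrightarrow> big_step (WHILE e DO c) s (1 + cost e) s"
| while_true: "val e s1 \<noteq> Nl \<Longrightarrow> big_step c s1 t1 s2 \<Longrightarrow> big_step (WHILE e DO c) s2 t2 s3 \<Longrightarrow>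
    big_step (WHILE e DO c) s1 (1 + cost e + t1 + t2) s3"

text \<open>\<^term>\<open>Nl\<close> is the answer no, every other tree is the answer yes.\<close>

definition answers :: "com \<Rightarrow> data \<Rightarrow> nat \<Rightarrow> bool \<Rightarrow> bool" where
  "answers c d t b \<longleftrightarrow>
    (\<exists>s'. big_step c ((\<lambda>_. Nl)(''in'' := d)) t s' \<and> (s' ''out'' \<noteq> Nl \<longleftrightarrow> b))"

definition decides_within ::
  "('i \<Rightarrow> data) \<Rightarrow> com \<Rightarrow> 'i set \<Rightarrow> ('i \<Rightarrow> bool) \<Rightarrow> ('i \<Rightarrow> nat) \<Rightarrow> bool" where
  "decides_within enc c I Q f \<longleftrightarrow> (\<forall>i \<in> I. \<exists>t \<le> f i. answers c (enc i) t (Q i))"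

definition decides_in_polynomial_time ::
  "('i \<Rightarrow> data) \<Rightarrow> com \<Rightarrow> 'i set \<Rightarrow> ('i \<Rightarrow> bool) \<Rightarrow> bool" where
  "decides_in_polynomial_time enc c I Q \<longleftrightarrow>
    (\<exists>p :: nat poly. decides_within enc c I Q (\<lambda>i. poly p (size (enc i))))"


section \<open>Instances\<close>

text \<open>Vertices are natural numbers in binary, least significant digit first.\<close>

fun bits :: "nat \<Rightarrow> bool list" where
  "bits n = (if n = 0 then [] else odd n # bits (n div 2))"

declare bits.simps [simp del]

definition enc_list :: "('b \<Rightarrow> data) \<Rightarrow> 'b list \<Rightarrow> data" where
  "enc_list e xs = foldr (\<lambda>x d. Cn (e x) d) xs Nl"

definition enc_bool :: "bool \<Rightarrow> data" where
  "enc_bool b = (if b then Cn Nl Nl else Nl)"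

definition enc_edges :: "nat list list \<Rightarrow> data" where
  "enc_edges = enc_list (enc_list (\<lambda>v. enc_list enc_bool (bits v)))"

text \<open>
  An instance \<^term>\<open>(k, V, Es)\<close> consists of a \<^term>\<open>k\<close>-hypergraph on \<^term>\<open>V\<close> and a list
  \<^term>\<open>Es\<close> of its edges without repetitions.  Only the list is passed to the program.
\<close>

type_synonym inst = "nat \<times> nat set \<times> nat list list"

definition edge_list :: "nat list list \<Rightarrow> nat set set \<Rightarrow> bool" where
  "edge_list Es H \<longleftrightarrow>
    set ` set Es = H \<and> distinct (map set Es) \<and> (\<forall>E \<in> set Es. distinct E)"

definition instances :: "(nat \<Rightarrow> nat set \<Rightarrow> nat set set \<Rightarrow> bool) \<Rightarrow> inst set" where
  "instances C = {(k, V, Es). \<exists>H. hypergraph k V H \<and> 1 \<le> k \<and> k < card V \<and> edge_list Es H \<and> C k V H}"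

abbreviation all_instances :: "inst set" where
  "all_instances \<equiv> instances (\<lambda>k V H. True)"

definition enc_inst :: "inst \<Rightarrow> data" where
  "enc_inst = (\<lambda>(k, V, Es). enc_edges Es)"

definition holds :: "(nat \<Rightarrow> nat set \<Rightarrow> nat set set \<Rightarrow> bool) \<Rightarrow> inst \<Rightarrow> bool" where
  "holds P = (\<lambda>(k, V, Es). P k V (set ` set Es))"


section \<open>The procedure\<close>

abbreviation yes :: exp where
  "yes \<equiv> Pair Leaf Leaf"

text \<open>The variable \<^term>\<open>r\<close> holds the part of the list still to be processed.\<close>

definition foreach :: "vname \<Rightarrow> vname \<Rightarrow> vname \<Rightarrow> com \<Rightarrow> com" where
  "foreach x r L c = (r ::= V L;; WHILE V r DO (x ::= Hd (V r);; r ::= Tl (V r);; c))"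

definition same_vertex :: "vname \<Rightarrow> vname \<Rightarrow> vname \<Rightarrow> com" where
  "same_vertex a b res =
    (res ::= yes;; ''p'' ::= V a;; ''q'' ::= V b;;
     WHILE V ''p'' DO
       ((IF V ''q'' THEN
          (IF Hd (V ''p'')
           THEN (IF Hd (V ''q'') THEN SKIP ELSE res ::= Leaf)
           ELSE (IF Hd (V ''q'') THEN res ::= Leaf ELSE SKIP))
         ELSE res ::= Leaf);;
        ''p'' ::= Tl (V ''p'');; ''q'' ::= Tl (V ''q''));;
     (IF V ''q'' THEN res ::= Leaf ELSE SKIP))"

definition elem :: "vname \<Rightarrow> vname \<Rightarrow> vname \<Rightarrow> com" where
  "elem a E res =
    (res ::= Leaf;;
     foreach ''u'' ''us'' E
       (same_vertex ''u'' a ''eq'';; (IF V ''eq'' THEN res ::= yes ELSE SKIP)))"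

text \<open>
  Is \<open>(E - {a}) \<union> {b}\<close> an edge, where \<open>a \<in> E\<close> and \<open>b \<notin> E\<close>?  As all the sets involved have
  \<open>k\<close> elements, it suffices to look for a listed edge \<open>F\<close> that is contained in this set.
\<close>

definition swap_is_edge :: "vname \<Rightarrow> vname \<Rightarrow> vname \<Rightarrow> vname \<Rightarrow> com" where
  "swap_is_edge E a b res =
    (res ::= Leaf;;
     foreach ''F'' ''Fs'' ''in''
       (''sub'' ::= yes;;
        foreach ''w'' ''ws'' ''F''
          (same_vertex ''w'' a ''isa'';; same_vertex ''w'' b ''isb'';; elem ''w'' E ''inE'';;
           (IF V ''isb'' THEN SKIP
            ELSE IF V ''isa'' THEN ''sub'' ::= Leaf
            ELSE IF V ''inE'' THEN SKIP
            ELSE ''sub'' ::= Leaf));;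
        (IF V ''sub'' THEN res ::= yes ELSE SKIP)))"

definition exchange_test :: com where
  "exchange_test =
    (''out'' ::= Leaf;;
     foreach ''E1'' ''E1s'' ''in'' (foreach ''E2'' ''E2s'' ''in''
       (foreach ''v1'' ''v1s'' ''E1'' (foreach ''v2'' ''v2s'' ''E2''
         (elem ''v1'' ''E2'' ''c1'';; elem ''v2'' ''E1'' ''c2'';;
          (IF V ''c1'' THEN SKIP ELSE IF V ''c2'' THEN SKIP
           ELSE
            (swap_is_edge ''E1'' ''v1'' ''v2'' ''d1'';;
             swap_is_edge ''E2'' ''v2'' ''v1'' ''d2'';;
             (IF V ''d1'' THEN SKIP ELSE IF V ''d2'' THEN SKIP
              ELSE ''out'' ::= yes))))))))"

definition negated :: "com \<Rightarrow> com" where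
  "negated c = (c;; (IF V ''out'' THEN ''out'' ::= Leaf ELSE ''out'' ::= yes))"

end

theory Submission
  imports Defs
begin

text \<open>
  If the hypergraph is not 2-monotone, some two sets \<open>R1\<close>, \<open>R2\<close> of the same size
  are incomparable; since their union has at most two elements, they are singletons
  \<open>{v1}\<close> and \<open>{v2}\<close>, and the two sets \<open>S\<close> that witness the
  incomparability become, after adding \<open>v1\<close> and \<open>v2\<close>, exactly the pair of
  edges of an exchange. The converse is the same computation read backwards
  (\<open>two_monotone_iff_not_exchangeable\<close>).

  That equatability is the complement of separability is Gordan's theorem of the alternative for the
  characteristic vectors of the edges and the negated characteristic vectors of the non-edges. A
  strict solution of the linear inequalities is a separating labeling, and a nonnegative dependency is
  an equating one (\<open>separable_or_equatable\<close>). Gordan's theorem follows by Fourier-Motzkin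
  elimination of one coordinate at a time (\<open>gordan\<close>). That the two properties exclude
  each other follows by summing the labels of all edges, weighted, in two ways.

  The rest is a verification of the program. A judgement \<open>runs c s T Q\<close> combines
  termination within time \<open>T\<close> with a postcondition. All loops of the program but the
  comparison of two vertices walk through a list and raise (or lower) a single flag as soon as some
  entry has a certain property, so one rule, \<open>runs_foreach\<close>, covers them all: the flag is
  raised afterwards iff it was raised before or some entry has the property. Counting the nested loops
  over at most \<open>m\<close> edges with at most \<open>K\<close> vertices of at most
  \<open>L\<close> bits gives a running time of \<open>O(m ^ 3 * K ^ 4 * L)\<close>: there are
  \<open>m ^ 2 * K ^ 2\<close> candidates for an exchange, and for each of them, looking for a
  set of vertices in the list of edges takes \<open>O(m * K ^ 2 * L)\<close> steps
  (\<open>runs_exchange_test\<close>).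

  Two choices of \<open>K\<close> and \<open>L\<close> give the two kinds of bounds. In terms of
  \<open>m\<close>, \<open>k\<close> and the largest vertex, \<open>K = k\<close> and
  \<open>L\<close> is the number of bits of that vertex. For a polynomial in the size of the input,
  however, the vertex set is of no use, since isolated vertices may be arbitrarily large and the
  parameter \<open>k\<close> is not bounded by the input when there are no edges; there
  \<open>K\<close> and \<open>L\<close> are both one more than the size of the encoding, which bounds
  what the program actually reads (\<open>bounded_edges_size\<close>).
\<close>


section \<open>Exchanges and 2-monotonicity\<close>

lemma two_monotone_iff_not_exchangeable:
  fixes V :: "'a set"
  assumes "hypergraph k V H"
  shows "two_monotone V H \<longleftrightarrow> \<not> exchangeable k V H"
proof
  assume mono: "two_monotone V H"
  show "\<not> exchangeable k V H"
  proof
    assume "exchangeable k V H"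
    then obtain E1 E2 v1 v2 where E: "E1 \<in> H" "E2 \<in> H" "v1 \<in> E1 - E2" "v2 \<in> E2 - E1"
      and N: "(E1 - {v1}) \<union> {v2} \<notin> H" "(E2 - {v2}) \<union> {v1} \<notin> H"
      unfolding exchangeable_def non_edges_def by blast
    have sub: "E1 \<subseteq> V" "E2 \<subseteq> V"
      using E assms unfolding hypergraph_def nsets_def by auto
    have "dominated V H {v1} {v2} \<or> dominated V H {v2} {v1}"
    proof -
      have "card ({v1} \<union> {v2}) \<le> 2"
        by (simp add: card_insert_if)
      then show ?thesis
        using mono E sub unfolding two_monotone_def
        by (metis DiffD1 card.empty card_insert_disjoint empty_iff empty_subsetI finite.emptyI
            insert_subset subset_iff)
    qed
    moreover have "E1 - {v1} \<union> {v1} = E1" "E2 - {v2} \<union> {v2} = E2"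
      using E by auto
    moreover have "E1 - {v1} \<subseteq> V - ({v1} \<union> {v2})" "E2 - {v2} \<subseteq> V - ({v2} \<union> {v1})"
      using E sub by auto
    ultimately show False
      using N E(1,2) unfolding dominated_def by metis
  qed
next
  assume not_ex: "\<not> exchangeable k V H"
  show "two_monotone V H"
    unfolding two_monotone_def
  proof (intro allI impI)
    fix R1 R2 :: "'a set"
    assume R: "R1 \<subseteq> V" "R2 \<subseteq> V" "card R1 = card R2" "card (R1 \<union> R2) \<le> 2"
    have finV: "finite V"
      using assms by (simp add: hypergraph_def)
    then have fin: "finite R1" "finite R2"
      using R finite_subset by blast+
    show "dominated V H R1 R2 \<or> dominated V H R2 R1"
    proof (cases "R1 = R2")
      case True
      then show ?thesis by (simp add: dominated_def)
    next
      case False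
      \<comment> \<open>Distinct sets of the same size whose union has at most two elements are singletons.\<close>
      have "\<not> R2 \<subseteq> R1"
        using False R(3) fin by (metis card_subset_eq)
      then have "card R1 < card (R1 \<union> R2)"
        using fin by (intro psubset_card_mono) auto
      then have "card R1 \<le> 1"
        using R(4) by linarith
      moreover have "card R1 \<noteq> 0"
        using False R(3) fin by auto
      ultimately have "card R1 = 1" "card R2 = 1"
        using R(3) by auto
      then obtain v1 v2 where v: "R1 = {v1}" "R2 = {v2}"
        by (auto simp: card_1_singleton_iff)
      show ?thesis
      proof (rule ccontr)
        assume "\<not> ?thesis"
        then obtain S1 S2 where
          S1: "S1 \<subseteq> V - {v1, v2}" "S1 \<union> {v1} \<in> H" "S1 \<union> {v2} \<notin> H" and
          S2: "S2 \<subseteq> V - {v1, v2}" "S2 \<union> {v2} \<in> H" "S2 \<union> {v1} \<notin> H"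
          unfolding dominated_def v by (auto simp: insert_commute)
        have ne: "v1 \<noteq> v2"
          using False v by auto
        have nonedge: "S \<union> {b} \<in> non_edges k V H"
          if S: "S \<subseteq> V - {v1, v2}" "S \<union> {a} \<in> H" "S \<union> {b} \<notin> H"
            and ab: "a \<in> {v1, v2}" "b \<in> {v1, v2}" for S a b
        proof -
          have "finite S"
            using finV S(1) finite_subset by blast
          moreover have "a \<notin> S" "b \<notin> S"
            using S(1) ab by auto
          ultimately have "card (S \<union> {b}) = card (S \<union> {a})"
            by simp
          moreover have "S \<union> {b} \<subseteq> V"
            using S(1) ab R v by auto
          ultimately show ?thesis
            using S(2,3) assms \<open>finite S\<close>
            unfolding non_edges_def hypergraph_def nsets_def by auto
        qed
        have "exchangeable k V H"
          unfolding exchangeable_def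
        proof (intro bexI conjI)
          have "(S1 \<union> {v1}) - {v1} \<union> {v2} = S1 \<union> {v2}" "(S2 \<union> {v2}) - {v2} \<union> {v1} = S2 \<union> {v1}"
            using S1(1) S2(1) by auto
          then show "(S1 \<union> {v1}) - {v1} \<union> {v2} \<in> non_edges k V H"
            and "(S2 \<union> {v2}) - {v2} \<union> {v1} \<in> non_edges k V H"
            using nonedge[OF S1] nonedge[OF S2] by auto
          show "v1 \<in> S1 \<union> {v1} - (S2 \<union> {v2})" "v2 \<in> S2 \<union> {v2} - (S1 \<union> {v1})"
            using S1(1) S2(1) ne by auto
        qed (use S1 S2 in auto)
        then show False
          using not_ex by blast
      qed
    qed
  qed
qed


section \<open>Gordan's alternative and separability\<close>

text \<open>
  The cone of all positive combinations of \<open>S\<close> with at least one nonzero coefficient.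
  Without the coefficients in the definition, the vectors produced by an elimination step lie in the
  cone of the original ones by mere closure, and coefficients are extracted only once, at the end.
\<close>

inductive_set pos_cone :: "('v \<Rightarrow> real) set \<Rightarrow> ('v \<Rightarrow> real) set" for S where
  gen: "a \<in> S \<Longrightarrow> a \<in> pos_cone S"
| add: "a \<in> pos_cone S \<Longrightarrow> b \<in> pos_cone S \<Longrightarrow> (\<lambda>v. a v + b v) \<in> pos_cone S"
| scale: "c > 0 \<Longrightarrow> a \<in> pos_cone S \<Longrightarrow> (\<lambda>v. c * a v) \<in> pos_cone S"

lemma pos_cone_idem:
  assumes "b \<in> pos_cone T" "T \<subseteq> pos_cone S"
  shows "b \<in> pos_cone S"
  using assms by induction (auto intro: pos_cone.intros)

lemma pos_cone_vanish:
  assumes "b \<in> pos_cone S" "\<And>a. a \<in> S \<Longrightarrow> a w = 0"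
  shows "b w = 0"
  using assms by induction auto

lemma pos_cone_coefficients:
  assumes "b \<in> pos_cone S" "finite S"
  shows "\<exists>y. (\<forall>a \<in> S. 0 \<le> y a) \<and> (\<exists>a \<in> S. y a \<noteq> 0) \<and> (\<forall>v. b v = (\<Sum>a\<in>S. y a * a v))"
  using assms(1)
proof induction
  case (gen a)
  then show ?case
    using assms(2) by (intro exI[of _ "\<lambda>b. if b = a then 1 else 0"]) (auto simp: if_distrib[of "\<lambda>x. x * _"] cong: if_cong)
next
  case (add a b)
  then obtain y z where
    "\<forall>a \<in> S. 0 \<le> y a" "\<exists>a \<in> S. y a \<noteq> 0" "\<forall>v. a v = (\<Sum>a\<in>S. y a * a v)"
    "\<forall>a \<in> S. 0 \<le> z a" "\<exists>a \<in> S. z a \<noteq> 0" "\<forall>v. b v = (\<Sum>a\<in>S. z a * a v)"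
    by blast
  then show ?case
    by (intro exI[of _ "\<lambda>a. y a + z a"])
      (auto simp: sum.distrib distrib_right add_nonneg_eq_0_iff)
next
  case (scale c a)
  then obtain y where
    "\<forall>a \<in> S. 0 \<le> y a" "\<exists>a \<in> S. y a \<noteq> 0" "\<forall>v. a v = (\<Sum>a\<in>S. y a * a v)"
    by blast
  with scale(1) show ?case
    by (intro exI[of _ "\<lambda>a. c * y a"]) (auto simp: sum_distrib_left mult.assoc)
qed

text \<open>
  The value of the eliminated coordinate in Fourier-Motzkin elimination is chosen by this fact; the
  empty cases occur when that coordinate is bounded from one side only.
\<close>

lemma finite_sets_separated:
  fixes A B :: "real set"
  assumes fin: "finite A" "finite B" and lt: "\<And>a b. a \<in> A \<Longrightarrow> b \<in> B \<Longrightarrow> a < b"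
  shows "\<exists>t. (\<forall>a \<in> A. a < t) \<and> (\<forall>b \<in> B. t < b)"
proof -
  define l where "l = (if A = {} then if B = {} then 0 else Min B - 1 else Max A)"
  define u where "u = (if B = {} then l + 1 else Min B)"
  have "Max A < Min B" if "A \<noteq> {}" "B \<noteq> {}"
    using that fin lt by simp
  then have "l < u"
    unfolding l_def u_def by (simp del: Min_gr_iff Max_less_iff)
  then obtain t where "l < t" "t < u"
    using dense by blast
  moreover have "a \<le> l" if "a \<in> A" for a
    using that fin unfolding l_def by auto
  moreover have "u \<le> b" if "b \<in> B" for b
    using that fin unfolding u_def by auto
  ultimately show ?thesis
    by (meson le_less_trans less_le_trans)
qed

text \<open>
  Fourier-Motzkin elimination. A vector \<open>a\<close> with \<open>a w > 0\<close> bounds the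
  coordinate \<open>x w\<close> from below, one with \<open>a w < 0\<close> bounds it from above,
  and \<open>elim a b\<close> is the combination that says that a lower bound is less than an upper
  one. A solution of the eliminated system therefore leaves room for \<open>x w\<close>; a
  combination of the eliminated vectors that vanishes on \<open>V\<close> also vanishes at
  \<open>w\<close>, because all of them do.
\<close>

lemma gordan:
  fixes V :: "'v set" and S :: "('v \<Rightarrow> real) set"
  assumes "finite V" "finite S"
  shows "(\<exists>x. \<forall>a \<in> S. (\<Sum>v\<in>V. a v * x v) > 0) \<or> (\<exists>b \<in> pos_cone S. \<forall>v \<in> V. b v = 0)"
  using assms
proof (induction V arbitrary: S rule: finite_induct)
  case empty
  then show ?case by (auto intro: pos_cone.gen)
next
  case (insert w V)
  define P where "P = {a \<in> S. a w > 0}"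
  define N where "N = {a \<in> S. a w < 0}"
  define elim where "elim a b = (\<lambda>v. inverse (a w) * a v + inverse (- b w) * b v)" for a b :: "'v \<Rightarrow> real"
  define S' where "S' = {a \<in> S. a w = 0} \<union> (\<lambda>(a, b). elim a b) ` (P \<times> N)"
  have fin: "finite P" "finite N" "finite S'"
    using insert.prems by (auto simp: P_def N_def S'_def)
  have "elim a b \<in> pos_cone S" if "a \<in> P" "b \<in> N" for a b
    using that unfolding elim_def P_def N_def
    by (intro pos_cone.add pos_cone.scale pos_cone.gen) auto
  then have sub: "S' \<subseteq> pos_cone S"
    by (auto simp: S'_def intro: pos_cone.gen)
  have vanish: "a w = 0" if "a \<in> S'" for a
    using that by (auto simp: S'_def elim_def P_def N_def)
  consider x where "\<forall>a \<in> S'. (\<Sum>v\<in>V. a v * x v) > 0" | b where "b \<in> pos_cone S'" "\<forall>v \<in> V. b v = 0"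
    using insert.IH[OF fin(3)] by blast
  then show ?case
  proof cases
    case 1
    define g where "g a = (\<Sum>v\<in>V. a v * x v)" for a
    have "- g a / a w < - g b / b w" if "a \<in> P" "b \<in> N" for a b
    proof -
      have "g (elim a b) > 0"
        using 1 that unfolding S'_def g_def by auto
      moreover have "g (elim a b) = inverse (a w) * g a + inverse (- b w) * g b"
        unfolding g_def elim_def by (simp add: left_diff_distrib sum_subtractf sum_negf sum_distrib_left mult.assoc)
      ultimately show ?thesis
        by (simp add: field_simps)
    qed
    then have "\<exists>t. (\<forall>z \<in> (\<lambda>a. - g a / a w) ` P. z < t) \<and> (\<forall>z \<in> (\<lambda>b. - g b / b w) ` N. t < z)"
      by (intro finite_sets_separated finite_imageI fin) blast
    then obtain t where t: "\<forall>a \<in> P. - g a / a w < t" "\<forall>b \<in> N. t < - g b / b w"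
      unfolding ball_simps by (elim exE conjE) (rule that)
    have "(\<Sum>v\<in>insert w V. a v * (x(w := t)) v) > 0" if a: "a \<in> S" for a
    proof -
      have "(\<Sum>v\<in>V. a v * (x(w := t)) v) = g a"
        unfolding g_def using insert.hyps by (intro sum.cong) auto
      then have eq: "(\<Sum>v\<in>insert w V. a v * (x(w := t)) v) = a w * t + g a"
        using insert.hyps by simp
      consider "a w = 0" | "a \<in> P" "a w > 0" | "a \<in> N" "a w < 0"
        using a by (cases rule: linorder_cases[of "a w" 0]) (auto simp: P_def N_def)
      then have "a w * t + g a > 0"
      proof cases
        case 1
        then show ?thesis
          using \<open>\<forall>a \<in> S'. _\<close> a by (auto simp: S'_def g_def)
      next
        case 2
        then show ?thesis
          using t(1)[rule_format, of a] by (simp add: field_simps)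
      next
        case 3
        then show ?thesis
          using t(2)[rule_format, of a] by (simp add: field_simps)
      qed
      then show ?thesis
        using eq by simp
    qed
    then show ?thesis
      by (intro disjI1 exI[of _ "x(w := t)"] ballI)
  next
    case 2
    have "b w = 0"
      using 2(1) vanish by (rule pos_cone_vanish)
    then have "\<forall>v \<in> insert w V. b v = 0"
      using 2(2) by simp
    moreover have "b \<in> pos_cone S"
      using 2(1) sub by (rule pos_cone_idem)
    ultimately show ?thesis by blast
  qed
qed

text \<open>
  Multiplying the balance at \<open>v\<close> by \<open>x v\<close> and summing over all vertices
  shows that the \<open>y\<close>-weighted sums of \<open>x(E)\<close> over the edges and over
  the non-edges are equal. The first is nonnegative, the second nonpositive, so both are zero. As
  \<open>x\<close> is strictly negative on non-edges, \<open>y\<close> vanishes there, hence by the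
  balance also on every edge that has a vertex.
\<close>

lemma separable_imp_not_equatable:
  fixes V :: "'a set"
  assumes H: "hypergraph k V H" and k: "1 \<le> k" and sep: "separable k V H"
  shows "\<not> equatable k V H"
proof
  assume "equatable k V H"
  then obtain y :: "'a set \<Rightarrow> real" where
    y: "\<forall>E \<in> nsets V k. y E \<ge> 0" "\<exists>E \<in> nsets V k. y E \<noteq> 0"
    and bal: "\<forall>v \<in> V. (\<Sum>E \<in> {E \<in> H. v \<in> E}. y E) = (\<Sum>F \<in> {F \<in> non_edges k V H. v \<in> F}. y F)"
    unfolding equatable_def by blast
  obtain x :: "'a \<Rightarrow> real" where x: "H = {E. E \<subseteq> V \<and> card E = k \<and> (\<Sum>v\<in>E. x v) \<ge> 0}"
    using sep unfolding separable_def by blast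
  have finV: "finite V" and HV: "H \<subseteq> nsets V k"
    using H by (auto simp: hypergraph_def)
  have fin: "finite H" "finite (non_edges k V H)"
    using finite_imp_finite_nsets[OF finV, of k] HV finite_subset
    unfolding non_edges_def by auto
  \<comment> \<open>double counting of the pairs of a vertex and a set that contains it\<close>
  have double: "(\<Sum>v\<in>V. x v * (\<Sum>E \<in> {E \<in> A. v \<in> E}. y E)) = (\<Sum>E\<in>A. y E * (\<Sum>v\<in>E. x v))"
    if A: "A \<subseteq> nsets V k" for A
  proof -
    have finA: "finite A"
      using A finite_imp_finite_nsets[OF finV] finite_subset by blast
    have "(\<Sum>v\<in>V. x v * (\<Sum>E \<in> {E \<in> A. v \<in> E}. y E)) = (\<Sum>v\<in>V. \<Sum>E\<in>{E \<in> A. v \<in> E}. x v * y E)"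
      by (simp add: sum_distrib_left)
    also have "\<dots> = (\<Sum>E\<in>A. \<Sum>v\<in>{v \<in> V. v \<in> E}. x v * y E)"
      using finV finA by (rule sum.swap_restrict)
    also have "\<dots> = (\<Sum>E\<in>A. y E * (\<Sum>v\<in>E. x v))"
    proof (rule sum.cong[OF refl])
      fix E assume "E \<in> A"
      then have "{v \<in> V. v \<in> E} = E" using A by (auto simp: nsets_def)
      then show "(\<Sum>v\<in>{v \<in> V. v \<in> E}. x v * y E) = y E * (\<Sum>v\<in>E. x v)"
        by (simp add: sum_distrib_left mult.commute)
    qed
    finally show ?thesis .
  qed
  have "(\<Sum>E\<in>H. y E * (\<Sum>v\<in>E. x v)) = (\<Sum>F\<in>non_edges k V H. y F * (\<Sum>v\<in>F. x v))"
    using double[OF HV] double[of "non_edges k V H"] bal by (simp add: non_edges_def)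
  moreover have "(\<Sum>E\<in>H. y E * (\<Sum>v\<in>E. x v)) \<ge> 0"
  proof (rule sum_nonneg)
    fix E assume E: "E \<in> H"
    then have "0 \<le> y E" using y(1) HV by auto
    moreover have "0 \<le> (\<Sum>v\<in>E. x v)" using E unfolding x by simp
    ultimately show "0 \<le> y E * (\<Sum>v\<in>E. x v)" by simp
  qed
  ultimately have "(\<Sum>F\<in>non_edges k V H. y F * - (\<Sum>v\<in>F. x v)) \<le> 0"
    by (simp add: sum_negf)
  moreover have neg: "(\<Sum>v\<in>F. x v) < 0" "0 \<le> y F" if "F \<in> non_edges k V H" for F
    using that y(1) x unfolding non_edges_def nsets_def by auto
  ultimately have "(\<Sum>F\<in>non_edges k V H. y F * - (\<Sum>v\<in>F. x v)) = 0"
    by (intro antisym sum_nonneg mult_nonneg_nonneg) (auto simp: less_imp_le)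
  then have "\<forall>F \<in> non_edges k V H. y F * - (\<Sum>v\<in>F. x v) = 0"
    using neg fin(2) by (subst (asm) sum_nonneg_eq_0_iff) (auto simp: mult_nonneg_nonpos less_imp_le)
  then have zero_non: "y F = 0" if "F \<in> non_edges k V H" for F
    using neg(1)[OF that] that by auto
  have zero_edge: "y E = 0" if E: "E \<in> H" for E
  proof -
    have "E \<noteq> {}"
      using E HV k by (auto simp: nsets_def)
    then obtain v where v: "v \<in> E" by blast
    then have "v \<in> V"
      using E HV by (auto simp: nsets_def)
    then have "(\<Sum>E \<in> {E \<in> H. v \<in> E}. y E) = 0"
      using bal zero_non by simp
    then have "\<forall>E \<in> {E \<in> H. v \<in> E}. y E = 0"
      using fin(1) y(1) HV by (subst (asm) sum_nonneg_eq_0_iff) auto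
    then show ?thesis using v E by blast
  qed
  show False
    using y(2) zero_non zero_edge unfolding non_edges_def by blast
qed

text \<open>
  The vector of an edge determines the edge as its support, so a dependency among the vectors is the
  same thing as a labeling of the \<open>k\<close>-sets.
\<close>

lemma separable_or_equatable:
  fixes V :: "'a set"
  assumes H: "hypergraph k V H" and k: "1 \<le> k"
  shows "separable k V H \<or> equatable k V H"
proof -
  define vec :: "'a set \<Rightarrow> 'a \<Rightarrow> real"
    where "vec E = (\<lambda>v. if v \<in> E then (if E \<in> H then 1 else - 1) else 0)" for E
  have supp: "{v. vec E v \<noteq> 0} = E" for E
    by (auto simp: vec_def)
  have inj: "inj_on vec A" for A
    by (rule inj_onI) (metis supp)
  have finV: "finite V" and HV: "H \<subseteq> nsets V k"
    using H by (auto simp: hypergraph_def)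
  have fin: "finite (nsets V k)"
    using finite_imp_finite_nsets[OF finV] .
  consider x where "\<forall>a \<in> vec ` nsets V k. (\<Sum>v\<in>V. a v * x v) > 0"
    | b where "b \<in> pos_cone (vec ` nsets V k)" "\<forall>v \<in> V. b v = 0"
    using gordan[OF finV, of "vec ` nsets V k"] fin by blast
  then show ?thesis
  proof cases
    case 1
    have pos: "0 < (if E \<in> H then 1 else - 1) * (\<Sum>v\<in>E. x v)" if E: "E \<in> nsets V k" for E
    proof -
      have "(\<Sum>v\<in>V. vec E v * x v) = (\<Sum>v\<in>E. (if E \<in> H then 1 else - 1) * x v)"
        using E finV by (intro sum.mono_neutral_cong_right) (auto simp: vec_def nsets_def)
      moreover have "0 < (\<Sum>v\<in>V. vec E v * x v)"
        using 1 E by auto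
      ultimately show ?thesis
        by (simp only: sum_distrib_left)
    qed
    have "E \<in> H \<longleftrightarrow> 0 \<le> (\<Sum>v\<in>E. x v)" if "E \<in> nsets V k" for E
      using pos[OF that] by (auto split: if_splits)
    moreover have "E \<in> nsets V k \<longleftrightarrow> E \<subseteq> V \<and> card E = k" for E
      using finV finite_subset by (auto simp: nsets_def)
    ultimately have "separable k V H"
      using HV unfolding separable_def by (intro exI[of _ x]) blast
    then show ?thesis ..
  next
    case 2
    obtain y where y: "\<forall>a \<in> vec ` nsets V k. 0 \<le> y a" "\<exists>a \<in> vec ` nsets V k. y a \<noteq> 0"
      and b: "\<forall>v. b v = (\<Sum>a\<in>vec ` nsets V k. y a * a v)"
      using pos_cone_coefficients[OF 2(1)] fin by blast
    have "(\<Sum>E \<in> {E \<in> H. v \<in> E}. y (vec E)) = (\<Sum>F \<in> {F \<in> non_edges k V H. v \<in> F}. y (vec F))"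
      if v: "v \<in> V" for v
    proof -
      let ?A = "{E \<in> H. v \<in> E}" and ?B = "{F \<in> non_edges k V H. v \<in> F}"
      have finAB: "finite ?A" "finite ?B"
        using finite_subset[OF HV fin] fin by (auto simp: non_edges_def)
      have "0 = (\<Sum>E\<in>nsets V k. y (vec E) * vec E v)"
        using 2(2) v b by (simp add: sum.reindex[OF inj])
      also have "\<dots> = (\<Sum>E\<in>?A \<union> ?B. y (vec E) * vec E v)"
        using fin HV by (intro sum.mono_neutral_right) (auto simp: vec_def non_edges_def)
      also have "\<dots> = (\<Sum>E\<in>?A. y (vec E) * vec E v) + (\<Sum>E\<in>?B. y (vec E) * vec E v)"
        using finAB by (intro sum.union_disjoint) (auto simp: non_edges_def)
      also have "(\<Sum>E\<in>?A. y (vec E) * vec E v) = (\<Sum>E\<in>?A. y (vec E))"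
        by (intro sum.cong) (auto simp: vec_def)
      also have "(\<Sum>E\<in>?B. y (vec E) * vec E v) = - (\<Sum>E\<in>?B. y (vec E))"
        unfolding sum_negf[symmetric] by (intro sum.cong) (auto simp: vec_def non_edges_def)
      finally show ?thesis by simp
    qed
    then have "equatable k V H"
      unfolding equatable_def using y by (intro exI[of _ "\<lambda>E. y (vec E)"]) auto
    then show ?thesis ..
  qed
qed

lemma separable_iff_not_equatable:
  fixes V :: "'a set"
  assumes "hypergraph k V H" "1 \<le> k"
  shows "separable k V H \<longleftrightarrow> \<not> equatable k V H"
  using separable_imp_not_equatable[OF assms] separable_or_equatable[OF assms] by blast


section \<open>Hoare-style reasoning with running times\<close>

definition runs :: "com \<Rightarrow> state \<Rightarrow> nat \<Rightarrow> (state \<Rightarrow> bool) \<Rightarrow> bool" where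
  "runs c s T Q \<longleftrightarrow> (\<exists>t s'. big_step c s t s' \<and> t \<le> T \<and> Q s')"

lemma runs_mono:
  assumes "runs c s T Q" "T \<le> T'" "\<And>s'. Q s' \<Longrightarrow> Q' s'"
  shows "runs c s T' Q'"
  using assms unfolding runs_def by (meson order_trans)

lemma runs_skip:
  assumes "Q s" "1 \<le> T"
  shows "runs SKIP s T Q"
  using assms big_step.skip unfolding runs_def by blast

lemma runs_assign:
  assumes "Q (s(x := val e s))" "1 + cost e \<le> T"
  shows "runs (x ::= e) s T Q"
  using assms big_step.assign unfolding runs_def by blast

lemma runs_seq:
  assumes "runs c1 s T1 R" "\<And>s'. R s' \<Longrightarrow> runs c2 s' T2 Q" "1 + T1 + T2 \<le> T"
  shows "runs (c1;; c2) s T Q"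
proof -
  obtain t1 s1 where 1: "big_step c1 s t1 s1" "t1 \<le> T1" "R s1"
    using assms(1) unfolding runs_def by blast
  obtain t2 s2 where 2: "big_step c2 s1 t2 s2" "t2 \<le> T2" "Q s2"
    using assms(2)[OF 1(3)] unfolding runs_def by blast
  have "1 + t1 + t2 \<le> T"
    using 1(2) 2(2) assms(3) by linarith
  then show ?thesis
    using big_step.seq[OF 1(1) 2(1)] 2(3) unfolding runs_def by blast
qed

lemma runs_assign_seq:
  assumes "runs c (s(x := val e s)) T' Q" "2 + cost e + T' \<le> T"
  shows "runs (x ::= e;; c) s T Q"
  by (rule runs_seq[where R = "\<lambda>s'. s' = s(x := val e s)" and ?T1.0 = "1 + cost e" and ?T2.0 = T'])
    (use assms in \<open>auto intro: runs_assign\<close>)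

lemma runs_init:
  assumes "runs c s1 T' R" "s1 = s(x := val e s)" "2 + cost e + T' \<le> T" "\<And>s'. R s' \<Longrightarrow> Q s'"
  shows "runs (x ::= e;; c) s T Q"
  using assms by (intro runs_assign_seq[where T' = T']) (auto intro: runs_mono)

lemma runs_if:
  assumes "val e s \<noteq> Nl \<Longrightarrow> runs c1 s T' Q" "val e s = Nl \<Longrightarrow> runs c2 s T' Q"
    and "1 + cost e + T' \<le> T"
  shows "runs (IF e THEN c1 ELSE c2) s T Q"
proof (cases "val e s = Nl")
  case True
  then obtain t s' where "big_step c2 s t s'" "t \<le> T'" "Q s'"
    using assms(2) unfolding runs_def by blast
  then show ?thesis
    using big_step.if_false[OF True] assms(3) unfolding runs_def
    by (intro exI[of _ "1 + cost e + t"] exI[of _ s']) auto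
next
  case False
  then obtain t s' where "big_step c1 s t s'" "t \<le> T'" "Q s'"
    using assms(1) unfolding runs_def by blast
  then show ?thesis
    using big_step.if_true[OF False] assms(3) unfolding runs_def
    by (intro exI[of _ "1 + cost e + t"] exI[of _ s']) auto
qed

text \<open>
  With the remaining time computed by subtraction, nested conditionals with a numeral as time bound
  are handled by applying this rule repeatedly.
\<close>

lemma runs_if_diff:
  assumes "val e s \<noteq> Nl \<Longrightarrow> runs c1 s (T - (1 + cost e)) Q"
    and "val e s = Nl \<Longrightarrow> runs c2 s (T - (1 + cost e)) Q" and "1 + cost e \<le> T"
  shows "runs (IF e THEN c1 ELSE c2) s T Q"
  using assms by (intro runs_if[where T' = "T - (1 + cost e)"]) auto

lemma runs_while_end:
  assumes "val e s = Nl" "Q s" "1 + cost e \<le> T"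
  shows "runs (WHILE e DO c) s T Q"
  using assms big_step.while_false unfolding runs_def by blast

lemma runs_while_step:
  assumes "val e s \<noteq> Nl" "runs c s T1 R" "\<And>s'. R s' \<Longrightarrow> runs (WHILE e DO c) s' T2 Q"
    and "1 + cost e + T1 + T2 \<le> T"
  shows "runs (WHILE e DO c) s T Q"
proof -
  obtain t1 s1 where 1: "big_step c s t1 s1" "t1 \<le> T1" "R s1"
    using assms(2) unfolding runs_def by blast
  obtain t2 s2 where 2: "big_step (WHILE e DO c) s1 t2 s2" "t2 \<le> T2" "Q s2"
    using assms(3)[OF 1(3)] unfolding runs_def by blast
  have "1 + cost e + t1 + t2 \<le> T"
    using 1(2) 2(2) assms(4) by linarith
  then show ?thesis
    using big_step.while_true[OF assms(1) 1(1) 2(1)] 2(3) unfolding runs_def by blast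
qed

definition unchanged_outside :: "vname set \<Rightarrow> state \<Rightarrow> state \<Rightarrow> bool" where
  "unchanged_outside W s s' \<longleftrightarrow> (\<forall>y. y \<notin> W \<longrightarrow> s' y = s y)"

lemma unchanged_outside_refl [simp]: "unchanged_outside W s s"
  by (simp add: unchanged_outside_def)

lemma unchanged_outsideD: "unchanged_outside W s s' \<Longrightarrow> y \<notin> W \<Longrightarrow> s' y = s y"
  by (simp add: unchanged_outside_def)

lemma unchanged_outside_trans:
  "unchanged_outside W s s' \<Longrightarrow> unchanged_outside W' s' s'' \<Longrightarrow> W \<subseteq> W'' \<Longrightarrow> W' \<subseteq> W'' \<Longrightarrow> unchanged_outside W'' s s''"
  unfolding unchanged_outside_def by (metis subsetD)

lemma unchanged_outside_mono: "unchanged_outside W s s' \<Longrightarrow> W \<subseteq> W' \<Longrightarrow> unchanged_outside W' s s'"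
  unfolding unchanged_outside_def by blast

lemma unchanged_outside_upd: "unchanged_outside W s s' \<Longrightarrow> x \<in> W \<Longrightarrow> unchanged_outside W s (s'(x := d))"
  unfolding unchanged_outside_def by auto

lemma enc_list_Nil [simp]: "enc_list e [] = Nl"
  by (simp add: enc_list_def)

lemma enc_list_Cons [simp]: "enc_list e (x # xs) = Cn (e x) (enc_list e xs)"
  by (simp add: enc_list_def)

text \<open>
  The start state \<open>s0\<close> is kept apart from the current state \<open>s\<close> so that the
  body may be verified with the values that the variables outside of the frame had before the loop.
\<close>

lemma runs_while_list:
  assumes "s r = enc_list e xs" "unchanged_outside (insert x (insert r W)) s0 s"
    and r: "r \<notin> W" "r \<noteq> x" "res \<noteq> x" "res \<noteq> r"
    and body: "\<And>z s. z \<in> set xs \<Longrightarrow> unchanged_outside (insert x (insert r W)) s0 s \<Longrightarrow> s x = e z \<Longrightarrow>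
      runs c s T (\<lambda>s'. unchanged_outside W s s' \<and> (\<phi> (s' res) \<longleftrightarrow> \<phi> (s res) \<or> P z))"
  shows "runs (WHILE V r DO (x ::= Hd (V r);; r ::= Tl (V r);; c)) s (2 + length xs * (T + 10))
    (\<lambda>s'. unchanged_outside (insert x (insert r W)) s0 s' \<and> (\<phi> (s' res) \<longleftrightarrow> \<phi> (s res) \<or> (\<exists>z \<in> set xs. P z)))"
  using assms(1,2) body
proof (induction xs arbitrary: s)
  case Nil
  then show ?case by (auto intro: runs_while_end)
next
  case (Cons z zs)
  define s1 where "s1 = s(x := e z, r := enc_list e zs)"
  have s1: "unchanged_outside (insert x (insert r W)) s0 s1" "s1 x = e z" "s1 r = enc_list e zs" "s1 res = s res"
    using Cons.prems(1,2) r unfolding s1_def by (auto intro!: unchanged_outside_upd)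
  let ?R = "\<lambda>s'. unchanged_outside W s1 s' \<and> (\<phi> (s' res) \<longleftrightarrow> \<phi> (s1 res) \<or> P z)"
  have step: "runs (x ::= Hd (V r);; r ::= Tl (V r)) s 7 (\<lambda>s'. s' = s1)"
    by (rule runs_assign_seq[where T' = 3], rule runs_assign) (use Cons.prems(1) r in \<open>auto simp: s1_def\<close>)
  have "runs c s1 T ?R"
    using s1 by (intro Cons.prems(3)) auto
  then have "runs (x ::= Hd (V r);; r ::= Tl (V r);; c) s (8 + T) ?R"
    by (intro runs_seq[OF step, where ?T2.0 = T]) auto
  moreover have "runs (WHILE V r DO (x ::= Hd (V r);; r ::= Tl (V r);; c)) s' (2 + length zs * (T + 10))
    (\<lambda>s'. unchanged_outside (insert x (insert r W)) s0 s' \<and> (\<phi> (s' res) \<longleftrightarrow> \<phi> (s res) \<or> (\<exists>z \<in> set (z # zs). P z)))"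
    if s': "?R s'" for s'
  proof -
    have "s' r = enc_list e zs"
      using s' s1(3) r unchanged_outsideD by metis
    moreover have "unchanged_outside (insert x (insert r W)) s0 s'"
      using s' s1(1) by (auto intro: unchanged_outside_trans)
    ultimately show ?thesis
      using s' s1(4) Cons.prems(3) by (intro runs_mono[OF Cons.IH]) auto
  qed
  ultimately show ?case
    by (rule runs_while_step[rotated]) (use Cons.prems(1) in auto)
qed

text \<open>
  The predicate \<open>\<phi>\<close> says which value of the variable \<open>res\<close> counts as a
  raised flag. Searching for a witness uses a nonempty tree as the flag, checking all entries uses the
  leaf.
\<close>

lemma runs_foreach:
  assumes "s L = enc_list e xs"
    and r: "r \<notin> W" "r \<noteq> x" "res \<noteq> x" "res \<noteq> r"
    and body: "\<And>z s'. z \<in> set xs \<Longrightarrow> unchanged_outside (insert x (insert r W)) s s' \<Longrightarrow> s' x = e z \<Longrightarrow>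
      runs c s' T (\<lambda>s''. unchanged_outside W s' s'' \<and> (\<phi> (s'' res) \<longleftrightarrow> \<phi> (s' res) \<or> P z))"
    and "5 + length xs * (T + 10) \<le> T'"
  shows "runs (foreach x r L c) s T'
    (\<lambda>s'. unchanged_outside (insert x (insert r W)) s s' \<and> (\<phi> (s' res) \<longleftrightarrow> \<phi> (s res) \<or> (\<exists>z \<in> set xs. P z)))"
proof -
  define s1 where "s1 = s(r := s L)"
  have s1: "s1 r = enc_list e xs" "unchanged_outside (insert x (insert r W)) s s1" "s1 res = s res"
    using assms(1) r by (simp_all add: s1_def unchanged_outside_def)
  have "runs (WHILE V r DO (x ::= Hd (V r);; r ::= Tl (V r);; c)) s1 (2 + length xs * (T + 10))
    (\<lambda>s'. unchanged_outside (insert x (insert r W)) s s' \<and>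
      (\<phi> (s' res) \<longleftrightarrow> \<phi> (s1 res) \<or> (\<exists>z \<in> set xs. P z)))"
    using s1(1,2) r body by (rule runs_while_list)
  then show ?thesis
    unfolding foreach_def using assms(7) s1(3)
    by (intro runs_assign_seq[where T' = "2 + length xs * (T + 10)"]) (auto simp: s1_def)
qed

text \<open>
  If the body costs \<open>A\<close> units of size \<open>B\<close>, the whole loop costs
  \<open>A + 15\<close> units of size \<open>N * B\<close>: every nested loop contributes one
  factor to the unit and only an additive constant to the coefficient.
\<close>

lemma loop_bound:
  fixes n N A B :: nat
  assumes "n \<le> N" "1 \<le> N" "1 \<le> B"
  shows "5 + n * (A * B + 10) \<le> (A + 15) * (N * B)"
proof -
  have "A * B + 10 \<le> (A + 10) * B"
    using assms by (simp add: add_mult_distrib)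
  then have "n * (A * B + 10) \<le> N * ((A + 10) * B)"
    using assms by (intro mult_le_mono) auto
  moreover have "1 \<le> N * B"
    using assms by (metis mult_le_mono nat_mult_1)
  ultimately have "5 + n * (A * B + 10) \<le> 5 * (N * B) + N * ((A + 10) * B)"
    by linarith
  also have "\<dots> = (A + 15) * (N * B)"
    by (simp add: algebra_simps)
  finally show ?thesis .
qed


section \<open>Correctness and running time of the procedure\<close>

definition enc_vertex :: "nat \<Rightarrow> data" where
  "enc_vertex v = enc_list enc_bool (bits v)"

lemma length_bits: "length (bits v) = floorlog 2 v"
proof (induction v rule: less_induct)
  case (less v)
  then show ?case
    by (subst bits.simps, subst compute_floorlog) auto
qed

lemma bits_inject: "bits v = bits w \<longleftrightarrow> v = w"
proof (induction v arbitrary: w rule: less_induct)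
  case (less v)
  show ?case
  proof (cases "v = 0 \<or> w = 0")
    case True
    then show ?thesis
      by (subst bits.simps, subst (2) bits.simps) auto
  next
    case False
    then have "bits v = bits w \<longleftrightarrow> odd v = odd w \<and> bits (v div 2) = bits (w div 2)"
      by (subst bits.simps, subst (2) bits.simps) simp
    also have "\<dots> \<longleftrightarrow> odd v = odd w \<and> v div 2 = w div 2"
      using less[of "v div 2" "w div 2"] False by simp
    also have "\<dots> \<longleftrightarrow> v = w"
      by presburger
    finally show ?thesis .
  qed
qed

text \<open>
  The loop follows the first list only. If the second one is longer, its rest is still in
  \<open>''q''\<close> at the end, which is why the emptiness of \<open>''q''\<close> is part of the
  outcome; if it is shorter, the flag is lowered once \<open>''q''\<close> is exhausted.
\<close>

lemma runs_same_bits_loop: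
  assumes "s ''p'' = enc_list enc_bool xs" "s ''q'' = enc_list enc_bool ys"
    and res: "res \<notin> {''p'', ''q''}"
  shows "runs
    (WHILE V ''p'' DO
       ((IF V ''q'' THEN
          (IF Hd (V ''p'')
           THEN (IF Hd (V ''q'') THEN SKIP ELSE res ::= Leaf)
           ELSE (IF Hd (V ''q'') THEN res ::= Leaf ELSE SKIP))
         ELSE res ::= Leaf);;
        ''p'' ::= Tl (V ''p'');; ''q'' ::= Tl (V ''q''))) s (2 + length xs * 20)
    (\<lambda>s'. unchanged_outside {''p'', ''q'', res} s s' \<and> (s' res \<noteq> Nl \<and> s' ''q'' = Nl \<longleftrightarrow> s res \<noteq> Nl \<and> xs = ys))"
  (is "runs (WHILE _ DO (?test;; _;; _)) _ _ _")
  using assms(1,2)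
proof (induction xs arbitrary: s ys)
  case Nil
  then show ?case
    by (intro runs_while_end) (auto, (cases ys; simp)+)
next
  case (Cons b xs)
  have leaf_iff: "enc_bool b = Nl \<longleftrightarrow> \<not> b" for b
    by (simp add: enc_bool_def)
  \<comment> \<open>Comparing with the head of an exhausted second list counts as a mismatch.\<close>
  define ok where "ok \<longleftrightarrow> ys \<noteq> [] \<and> hd ys = b"
  let ?R1 = "\<lambda>s'. unchanged_outside {res} s s' \<and> (s' res \<noteq> Nl \<longleftrightarrow> s res \<noteq> Nl \<and> ok)"
  have test: "runs ?test s 10 ?R1"
    apply (rule runs_if[where T' = 8])
    subgoal
      apply (rule runs_if[where T' = 5])
      subgoal
        apply (rule runs_if[where T' = 2])
        subgoal by (rule runs_skip) (use Cons.prems in \<open>cases ys; auto simp: ok_def leaf_iff\<close>)+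
        subgoal by (rule runs_assign) (use Cons.prems in \<open>cases ys; auto simp: ok_def leaf_iff intro: unchanged_outside_upd\<close>)+
        by simp
      subgoal
        apply (rule runs_if[where T' = 2])
        subgoal by (rule runs_assign) (use Cons.prems in \<open>cases ys; auto simp: ok_def leaf_iff intro: unchanged_outside_upd\<close>)+
        subgoal by (rule runs_skip) (use Cons.prems in \<open>cases ys; auto simp: ok_def leaf_iff\<close>)+
        by simp
      by simp
    subgoal by (rule runs_assign) (use Cons.prems in \<open>cases ys; auto simp: ok_def intro: unchanged_outside_upd\<close>)+
    by simp
  let ?R = "\<lambda>s'. unchanged_outside {''p'', ''q'', res} s s' \<and> (s' res \<noteq> Nl \<longleftrightarrow> s res \<noteq> Nl \<and> ok)
    \<and> s' ''p'' = enc_list enc_bool xs \<and> s' ''q'' = enc_list enc_bool (tl ys)"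
  have "runs (?test;; ''p'' ::= Tl (V ''p'')) s 14
    (\<lambda>s'. unchanged_outside {''p'', res} s s' \<and> (s' res \<noteq> Nl \<longleftrightarrow> s res \<noteq> Nl \<and> ok) \<and> s' ''p'' = enc_list enc_bool xs)"
    using test
  proof (rule runs_seq)
    fix s' assume s': "?R1 s'"
    then have "s' ''p'' = s ''p''" using res unchanged_outsideD[of "{res}"] by auto
    then show "runs (''p'' ::= Tl (V ''p'')) s' 3
      (\<lambda>s'. unchanged_outside {''p'', res} s s' \<and> (s' res \<noteq> Nl \<longleftrightarrow> s res \<noteq> Nl \<and> ok) \<and> s' ''p'' = enc_list enc_bool xs)"
      using s' Cons.prems(1) res by (intro runs_assign) (auto intro: unchanged_outside_upd unchanged_outside_mono)
  qed simp
  then have body: "runs (?test;; ''p'' ::= Tl (V ''p'');; ''q'' ::= Tl (V ''q'')) s 18 ?R"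
  proof (rule runs_seq)
    fix s' assume s': "unchanged_outside {''p'', res} s s' \<and> (s' res \<noteq> Nl \<longleftrightarrow> s res \<noteq> Nl \<and> ok) \<and>
      s' ''p'' = enc_list enc_bool xs"
    then have "s' ''q'' = s ''q''" using res unchanged_outsideD[of "{''p'', res}"] by auto
    then have "tl_data (s' ''q'') = enc_list enc_bool (tl ys)"
      using Cons.prems(2) by (cases ys) auto
    then show "runs (''q'' ::= Tl (V ''q'')) s' 3 ?R"
      using s' res by (intro runs_assign) (auto intro: unchanged_outside_upd unchanged_outside_mono)
  qed simp
  show ?case
  proof (rule runs_while_step[OF _ body])
    fix s' assume s': "?R s'"
    have "b # xs = ys \<longleftrightarrow> ok \<and> xs = tl ys"
      by (cases ys) (auto simp: ok_def)
    then show "runs (WHILE V ''p'' DO (?test;; ''p'' ::= Tl (V ''p'');; ''q'' ::= Tl (V ''q''))) s'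
      (2 + length xs * 20)
      (\<lambda>s'. unchanged_outside {''p'', ''q'', res} s s' \<and> (s' res \<noteq> Nl \<and> s' ''q'' = Nl \<longleftrightarrow> s res \<noteq> Nl \<and> b # xs = ys))"
      using s' by (intro runs_mono[OF Cons.IH[of s' "tl ys"]]) (auto intro: unchanged_outside_trans)
  qed (use Cons.prems in auto)
qed

lemma runs_same_vertex:
  assumes "s a = enc_vertex v" "s b = enc_vertex w"
    and names: "a \<notin> {''p'', ''q'', res}" "b \<notin> {''p'', ''q'', res}" "res \<notin> {''p'', ''q''}"
    and L: "length (bits v) \<le> L" "1 \<le> L"
  shows "runs (same_vertex a b res) s (40 * L)
    (\<lambda>s'. unchanged_outside {''p'', ''q'', res} s s' \<and> (s' res \<noteq> Nl \<longleftrightarrow> v = w))"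
proof -
  define s1 where "s1 = s(res := Cn Nl Nl, ''p'' := enc_vertex v, ''q'' := enc_vertex w)"
  have "runs (res ::= yes;; ''p'' ::= V a) s 7 (\<lambda>s'. s' = s(res := Cn Nl Nl, ''p'' := enc_vertex v))"
    by (rule runs_assign_seq[where T' = 2], rule runs_assign) (use assms(1) names in auto)
  then have init: "runs (res ::= yes;; ''p'' ::= V a;; ''q'' ::= V b) s 10 (\<lambda>s'. s' = s1)"
    by (rule runs_seq[where ?T2.0 = 2]) (use assms(2) names in \<open>auto simp: s1_def intro!: runs_assign\<close>)
  have s1: "s1 ''p'' = enc_list enc_bool (bits v)" "s1 ''q'' = enc_list enc_bool (bits w)"
    "unchanged_outside {''p'', ''q'', res} s s1" "s1 res \<noteq> Nl"
    using names by (auto simp: s1_def enc_vertex_def intro!: unchanged_outside_upd)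
  show ?thesis
    unfolding same_vertex_def
    apply (rule runs_seq[where ?T1.0 = "13 + length (bits v) * 20" and ?T2.0 = 4])
      apply (rule runs_seq[OF init, where ?T2.0 = "2 + length (bits v) * 20"])
       apply hypsubst
       apply (rule runs_same_bits_loop[OF s1(1,2) names(3)])
      apply simp
    subgoal for s'
      apply (rule runs_if[where T' = 2])
        apply (rule runs_assign)
         apply (use s1 bits_inject in \<open>auto intro: unchanged_outside_upd unchanged_outside_trans\<close>)[2]
       apply (rule runs_skip)
        apply (use s1 bits_inject in \<open>auto intro: unchanged_outside_trans\<close>)[2]
      apply simp
      done
    using L by simp
qed

lemma runs_record:
  assumes "runs c s T (\<lambda>s'. unchanged_outside W s s' \<and> (s' x \<noteq> Nl \<longleftrightarrow> b))" "res \<notin> W"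
  shows "runs (c;; (IF V x THEN res ::= yes ELSE SKIP)) s (T + 7)
    (\<lambda>s'. unchanged_outside (insert res W) s s' \<and> (s' res \<noteq> Nl \<longleftrightarrow> s res \<noteq> Nl \<or> b))"
  using assms(1)
proof (rule runs_seq)
  fix s' assume s': "unchanged_outside W s s' \<and> (s' x \<noteq> Nl \<longleftrightarrow> b)"
  then have "s' res = s res"
    using assms(2) unchanged_outsideD by blast
  with s' show "runs (IF V x THEN res ::= yes ELSE SKIP) s' 6
    (\<lambda>s'. unchanged_outside (insert res W) s s' \<and> (s' res \<noteq> Nl \<longleftrightarrow> s res \<noteq> Nl \<or> b))"
    by (intro runs_if[where T' = 4]) (auto simp: unchanged_outside_def intro!: runs_assign runs_skip)
qed simp

lemma runs_elem:
  assumes "s a = enc_vertex v" "s E = enc_list enc_vertex xs"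
    and names: "a \<notin> {''u'', ''us'', ''eq'', ''p'', ''q'', res}" "E \<noteq> res"
      "res \<notin> {''u'', ''us'', ''eq'', ''p'', ''q''}"
    and K: "length xs \<le> K" "1 \<le> K"
    and L: "\<forall>w \<in> set xs. length (bits w) \<le> L" "1 \<le> L"
  shows "runs (elem a E res) s (65 * (K * L))
    (\<lambda>s'. unchanged_outside {''u'', ''us'', ''eq'', ''p'', ''q'', res} s s' \<and> (s' res \<noteq> Nl \<longleftrightarrow> v \<in> set xs))"
proof -
  let ?W = "{res, ''p'', ''q'', ''eq''}"
  have loop: "runs (foreach ''u'' ''us'' E
       (same_vertex ''u'' a ''eq'';; (IF V ''eq'' THEN res ::= yes ELSE SKIP))) (s(res := Nl)) (62 * (K * L))
     (\<lambda>s'. unchanged_outside (insert ''u'' (insert ''us'' ?W)) (s(res := Nl)) s' \<and>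
       (s' res \<noteq> Nl \<longleftrightarrow> (s(res := Nl)) res \<noteq> Nl \<or> (\<exists>w \<in> set xs. w = v)))"
  proof (rule runs_foreach[where T = "47 * L" and \<phi> = "\<lambda>d. d \<noteq> Nl"])
    fix w s'
    assume w: "w \<in> set xs" and s': "unchanged_outside (insert ''u'' (insert ''us'' ?W)) (s(res := Nl)) s'"
      "s' ''u'' = enc_vertex w"
    have "s' a = enc_vertex v"
      using s'(1) assms(1) names by (simp add: unchanged_outside_def)
    then have "runs (same_vertex ''u'' a ''eq'') s' (40 * L)
        (\<lambda>s''. unchanged_outside {''p'', ''q'', ''eq''} s' s'' \<and> (s'' ''eq'' \<noteq> Nl \<longleftrightarrow> w = v))"
      using s'(2) w L names by (intro runs_same_vertex) auto
    then show "runs (same_vertex ''u'' a ''eq'';; (IF V ''eq'' THEN res ::= yes ELSE SKIP)) s' (47 * L)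
      (\<lambda>s''. unchanged_outside ?W s' s'' \<and> (s'' res \<noteq> Nl \<longleftrightarrow> s' res \<noteq> Nl \<or> w = v))"
      using names L(2) by (intro runs_mono[OF runs_record]) auto
  next
    show "5 + length xs * (47 * L + 10) \<le> 62 * (K * L)"
      using loop_bound[OF K L(2), of 47] by simp
  qed (use assms(2) names in auto)
  have "1 \<le> K * L"
    using K L by simp
  then show ?thesis
    unfolding elem_def by (intro runs_init[OF loop]) (auto simp: unchanged_outside_def)
qed

text \<open>
  The bounds refer to the listed edges and not to the vertex set, which the program does not see. They
  are positive so that products of them absorb the constant costs of a loop.
\<close>

definition bounded_edges :: "nat \<Rightarrow> nat \<Rightarrow> nat list list \<Rightarrow> bool" where
  "bounded_edges K L Es \<longleftrightarrow>
    1 \<le> K \<and> 1 \<le> L \<and> (\<forall>E \<in> set Es. length E \<le> K \<and> (\<forall>v \<in> set E. length (bits v) \<le> L))"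

text \<open>
  Containment of a listed edge in \<open>(set xs - {v}) \<union> {w}\<close>, in the vertexwise
  form in which the program checks it.
\<close>

definition swap_listed :: "nat list list \<Rightarrow> nat list \<Rightarrow> nat \<Rightarrow> nat \<Rightarrow> bool" where
  "swap_listed Es xs v w \<longleftrightarrow> (\<exists>F \<in> set Es. \<forall>u \<in> set F. u = w \<or> u \<noteq> v \<and> u \<in> set xs)"

abbreviation sub_vars :: "vname set" where
  "sub_vars \<equiv> {''p'', ''q'', ''isa'', ''isb'', ''inE'', ''u'', ''us'', ''eq'', ''sub''}"

abbreviation swap_vars :: "vname set" where
  "swap_vars \<equiv> sub_vars \<union> {''w'', ''ws'', ''F'', ''Fs''}"

lemma runs_subset_test:
  assumes "s ''w'' = enc_vertex u" "s a = enc_vertex v" "s b = enc_vertex w" "s E = enc_list enc_vertex xs"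
    and names: "a \<notin> swap_vars" "b \<notin> swap_vars" "E \<notin> swap_vars"
    and K: "length xs \<le> K" "1 \<le> K"
    and L: "\<forall>w \<in> set xs. length (bits w) \<le> L" "length (bits u) \<le> L" "1 \<le> L"
  shows "runs (same_vertex ''w'' a ''isa'';; same_vertex ''w'' b ''isb'';; elem ''w'' E ''inE'';;
           (IF V ''isb'' THEN SKIP
            ELSE IF V ''isa'' THEN ''sub'' ::= Leaf
            ELSE IF V ''inE'' THEN SKIP
            ELSE ''sub'' ::= Leaf)) s (156 * (K * L))
    (\<lambda>s'. unchanged_outside sub_vars s s' \<and>
      (s' ''sub'' = Nl \<longleftrightarrow> s ''sub'' = Nl \<or> \<not> (u = w \<or> u \<noteq> v \<and> u \<in> set xs)))"
proof -
  have 1: "runs (same_vertex ''w'' a ''isa'') s (40 * L)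
    (\<lambda>s'. unchanged_outside {''p'', ''q'', ''isa''} s s' \<and> (s' ''isa'' \<noteq> Nl \<longleftrightarrow> u = v))"
    using assms by (intro runs_same_vertex) auto
  let ?R2 = "\<lambda>s'. unchanged_outside {''p'', ''q'', ''isa'', ''isb''} s s' \<and>
    (s' ''isa'' \<noteq> Nl \<longleftrightarrow> u = v) \<and> (s' ''isb'' \<noteq> Nl \<longleftrightarrow> u = w)"
  have 2: "runs (same_vertex ''w'' a ''isa'';; same_vertex ''w'' b ''isb'') s (80 * L + 1) ?R2"
    using 1
  proof (rule runs_seq)
    fix s1 assume s1: "unchanged_outside {''p'', ''q'', ''isa''} s s1 \<and> (s1 ''isa'' \<noteq> Nl \<longleftrightarrow> u = v)"
    then have "runs (same_vertex ''w'' b ''isb'') s1 (40 * L)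
      (\<lambda>s'. unchanged_outside {''p'', ''q'', ''isb''} s1 s' \<and> (s' ''isb'' \<noteq> Nl \<longleftrightarrow> u = w))"
      using assms by (intro runs_same_vertex) (auto simp: unchanged_outside_def)
    then show "runs (same_vertex ''w'' b ''isb'') s1 (40 * L) ?R2"
      by (rule runs_mono) (use s1 in \<open>auto simp: unchanged_outside_def\<close>)
  qed simp
  let ?R3 = "\<lambda>s'. unchanged_outside sub_vars s s' \<and> s' ''sub'' = s ''sub'' \<and>
    (s' ''isa'' \<noteq> Nl \<longleftrightarrow> u = v) \<and> (s' ''isb'' \<noteq> Nl \<longleftrightarrow> u = w) \<and> (s' ''inE'' \<noteq> Nl \<longleftrightarrow> u \<in> set xs)"
  have 3: "runs (same_vertex ''w'' a ''isa'';; same_vertex ''w'' b ''isb'';; elem ''w'' E ''inE'') s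
    (80 * L + 65 * (K * L) + 2) ?R3"
    using 2
  proof (rule runs_seq)
    fix s2 assume s2: "?R2 s2"
    then have "runs (elem ''w'' E ''inE'') s2 (65 * (K * L))
      (\<lambda>s'. unchanged_outside {''u'', ''us'', ''eq'', ''p'', ''q'', ''inE''} s2 s' \<and> (s' ''inE'' \<noteq> Nl \<longleftrightarrow> u \<in> set xs))"
      using assms by (intro runs_elem) (auto simp: unchanged_outside_def)
    then show "runs (elem ''w'' E ''inE'') s2 (65 * (K * L)) ?R3"
      by (rule runs_mono) (use s2 in \<open>auto simp: unchanged_outside_def\<close>)
  qed simp
  have "L \<le> K * L" "1 \<le> K * L"
    using K L by simp_all
  show ?thesis
    using 3
  proof (rule runs_seq)
    fix s3 assume "?R3 s3"
    then show "runs (IF V ''isb'' THEN SKIP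
            ELSE IF V ''isa'' THEN ''sub'' ::= Leaf
            ELSE IF V ''inE'' THEN SKIP
            ELSE ''sub'' ::= Leaf) s3 8
      (\<lambda>s'. unchanged_outside sub_vars s s' \<and>
        (s' ''sub'' = Nl \<longleftrightarrow> s ''sub'' = Nl \<or> \<not> (u = w \<or> u \<noteq> v \<and> u \<in> set xs)))"
      by (intro runs_if_diff runs_skip runs_assign)
        (auto simp: unchanged_outside_def)
  next
    show "1 + (80 * L + 65 * (K * L) + 2) + 8 \<le> 156 * (K * L)"
      using \<open>L \<le> K * L\<close> \<open>1 \<le> K * L\<close> by linarith
  qed
qed

lemma runs_swap_is_edge:
  assumes "s ''in'' = enc_list (enc_list enc_vertex) Es" "s a = enc_vertex v" "s b = enc_vertex w"
    "s E = enc_list enc_vertex xs"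
    and names: "a \<notin> insert res swap_vars" "b \<notin> insert res swap_vars" "E \<notin> insert res swap_vars"
      "res \<notin> insert ''in'' swap_vars"
    and Es: "bounded_edges K L Es" "xs \<in> set Es"
  shows "runs (swap_is_edge E a b res) s (202 * ((length Es + 1) * (K * (K * L))))
    (\<lambda>s'. unchanged_outside (insert res swap_vars) s s' \<and> (s' res \<noteq> Nl \<longleftrightarrow> swap_listed Es xs v w))"
proof -
  define good where "good u \<longleftrightarrow> u = w \<or> u \<noteq> v \<and> u \<in> set xs" for u
  have KL: "1 \<le> K" "1 \<le> L" and bnd: "\<And>F. F \<in> set Es \<Longrightarrow> length F \<le> K"
      "\<And>F u. F \<in> set Es \<Longrightarrow> u \<in> set F \<Longrightarrow> length (bits u) \<le> L"
    using Es(1) by (auto simp: bounded_edges_def)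
  then have "1 \<le> K * L" by simp
  then have "1 \<le> K * (K * L)" using KL(1) by simp
  let ?test = "same_vertex ''w'' a ''isa'';; same_vertex ''w'' b ''isb'';; elem ''w'' E ''inE'';;
           (IF V ''isb'' THEN SKIP
            ELSE IF V ''isa'' THEN ''sub'' ::= Leaf
            ELSE IF V ''inE'' THEN SKIP
            ELSE ''sub'' ::= Leaf)"
  let ?W = "insert res (sub_vars \<union> {''w'', ''ws''})"
  have edge: "runs (''sub'' ::= yes;; foreach ''w'' ''ws'' ''F'' ?test) s1 (177 * (K * (K * L)))
      (\<lambda>s'. unchanged_outside (sub_vars \<union> {''w'', ''ws''}) s1 s' \<and> (s' ''sub'' \<noteq> Nl \<longleftrightarrow> (\<forall>u \<in> set F. good u)))"
    if F: "F \<in> set Es" and s1: "unchanged_outside (insert ''F'' (insert ''Fs'' ?W)) (s(res := Nl)) s1"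
      "s1 ''F'' = enc_list enc_vertex F" for F s1
  proof -
    let ?s = "s1(''sub'' := Cn Nl Nl)"
    have loop: "runs (foreach ''w'' ''ws'' ''F'' ?test) ?s (171 * (K * (K * L)))
      (\<lambda>s'. unchanged_outside (insert ''w'' (insert ''ws'' sub_vars)) ?s s' \<and>
        (s' ''sub'' = Nl \<longleftrightarrow> ?s ''sub'' = Nl \<or> (\<exists>u \<in> set F. \<not> good u)))"
    proof (rule runs_foreach[where T = "156 * (K * L)" and \<phi> = "\<lambda>d. d = Nl"])
      fix u s2
      assume u: "u \<in> set F" and s2: "unchanged_outside (insert ''w'' (insert ''ws'' sub_vars)) ?s s2"
        "s2 ''w'' = enc_vertex u"
      show "runs ?test s2 (156 * (K * L)) (\<lambda>s'. unchanged_outside sub_vars s2 s' \<and>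
        (s' ''sub'' = Nl \<longleftrightarrow> s2 ''sub'' = Nl \<or> \<not> good u))"
        unfolding good_def
        by (rule runs_subset_test)
          (use s1 s2 u F assms bnd KL in \<open>auto simp: unchanged_outside_def\<close>)
    next
      show "5 + length F * (156 * (K * L) + 10) \<le> 171 * (K * (K * L))"
        using loop_bound[OF bnd(1)[OF F] KL(1) \<open>1 \<le> K * L\<close>, of 156] by simp
    qed (use s1 in auto)
    have "2 + cost yes + 171 * (K * (K * L)) \<le> 177 * (K * (K * L))"
      using \<open>1 \<le> K * (K * L)\<close> unfolding cost.simps by linarith
    then show ?thesis
      by (intro runs_init[OF loop]) (auto simp: unchanged_outside_def)
  qed
  let ?s = "s(res := Nl)"
  let ?b = "''sub'' ::= yes;; foreach ''w'' ''ws'' ''F'' ?test;; (IF V ''sub'' THEN res ::= yes ELSE SKIP)"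
  have loop: "runs (foreach ''F'' ''Fs'' ''in'' ?b) ?s (199 * ((length Es + 1) * (K * (K * L))))
    (\<lambda>s'. unchanged_outside (insert ''F'' (insert ''Fs'' ?W)) ?s s' \<and>
      (s' res \<noteq> Nl \<longleftrightarrow> ?s res \<noteq> Nl \<or> (\<exists>F \<in> set Es. \<forall>u \<in> set F. good u)))"
  proof (rule runs_foreach[where T = "184 * (K * (K * L))" and \<phi> = "\<lambda>d. d \<noteq> Nl"])
    fix F s1
    assume F: "F \<in> set Es" "unchanged_outside (insert ''F'' (insert ''Fs'' ?W)) ?s s1" "s1 ''F'' = enc_list enc_vertex F"
    show "runs ?b s1 (184 * (K * (K * L))) (\<lambda>s'. unchanged_outside ?W s1 s' \<and>
        (s' res \<noteq> Nl \<longleftrightarrow> s1 res \<noteq> Nl \<or> (\<forall>u \<in> set F. good u)))"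
      by (rule runs_mono[OF runs_record[OF edge[OF F]]]) (use names \<open>1 \<le> K * (K * L)\<close> in auto)
  next
    show "5 + length Es * (184 * (K * (K * L)) + 10) \<le> 199 * ((length Es + 1) * (K * (K * L)))"
      using loop_bound[OF _ _ \<open>1 \<le> K * (K * L)\<close>, of "length Es" "length Es + 1" 184] by simp
  qed (use assms(1) names in auto)
  have "1 \<le> (length Es + 1) * (K * (K * L))"
    using mult_le_mono[OF _ \<open>1 \<le> K * (K * L)\<close>, of 1 "length Es + 1"] by simp
  then have "2 + cost Leaf + 199 * ((length Es + 1) * (K * (K * L))) \<le> 202 * ((length Es + 1) * (K * (K * L)))"
    unfolding cost.simps by linarith
  then show ?thesis
    unfolding swap_is_edge_def swap_listed_def good_def[symmetric]
    by (intro runs_init[OF loop]) (auto simp: unchanged_outside_def)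
qed

definition exchange_listed :: "nat list list \<Rightarrow> bool" where
  "exchange_listed Es \<longleftrightarrow> (\<exists>E1 \<in> set Es. \<exists>E2 \<in> set Es. \<exists>v1 \<in> set E1. \<exists>v2 \<in> set E2.
    v1 \<notin> set E2 \<and> v2 \<notin> set E1 \<and> \<not> swap_listed Es E1 v1 v2 \<and> \<not> swap_listed Es E2 v2 v1)"

abbreviation test_vars :: "vname set" where
  "test_vars \<equiv> swap_vars \<union> {''c1'', ''c2'', ''d1'', ''d2'', ''out''}"

lemma runs_pair_test:
  assumes "s ''in'' = enc_list (enc_list enc_vertex) Es"
    and "s ''E1'' = enc_list enc_vertex E1" "s ''E2'' = enc_list enc_vertex E2"
    and "s ''v1'' = enc_vertex v1" "s ''v2'' = enc_vertex v2"
    and Es: "bounded_edges K L Es" "E1 \<in> set Es" "E2 \<in> set Es"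
  shows "runs (elem ''v1'' ''E2'' ''c1'';; elem ''v2'' ''E1'' ''c2'';;
          (IF V ''c1'' THEN SKIP ELSE IF V ''c2'' THEN SKIP
           ELSE
            (swap_is_edge ''E1'' ''v1'' ''v2'' ''d1'';;
             swap_is_edge ''E2'' ''v2'' ''v1'' ''d2'';;
             (IF V ''d1'' THEN SKIP ELSE IF V ''d2'' THEN SKIP
              ELSE ''out'' ::= yes)))) s (550 * ((length Es + 1) * (K * (K * L))))
    (\<lambda>s'. unchanged_outside test_vars s s' \<and> (s' ''out'' \<noteq> Nl \<longleftrightarrow> s ''out'' \<noteq> Nl \<or>
      v1 \<notin> set E2 \<and> v2 \<notin> set E1 \<and> \<not> swap_listed Es E1 v1 v2 \<and> \<not> swap_listed Es E2 v2 v1))"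
    (is "runs (_;; _;; (IF _ THEN _ ELSE IF _ THEN _ ELSE ?swaps)) _ _ ?Q")
proof -
  define B where "B = (length Es + 1) * (K * (K * L))"
  have KL: "1 \<le> K" "1 \<le> L" and bnd: "\<And>F. F \<in> set Es \<Longrightarrow> length F \<le> K"
      "\<And>F u. F \<in> set Es \<Longrightarrow> u \<in> set F \<Longrightarrow> length (bits u) \<le> L"
    using Es(1) by (auto simp: bounded_edges_def)
  then have "1 \<le> K * L" by simp
  then have "K * L \<le> B"
    using KL unfolding B_def by (metis le_add2 mult.left_neutral mult_le_mono order_refl)
  have "1 \<le> B"
    using \<open>1 \<le> K * L\<close> \<open>K * L \<le> B\<close> by linarith
  let ?V = "{''u'', ''us'', ''eq'', ''p'', ''q'', ''c1'', ''c2''}"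
  let ?R1 = "\<lambda>s'. unchanged_outside {''u'', ''us'', ''eq'', ''p'', ''q'', ''c1''} s s' \<and> (s' ''c1'' \<noteq> Nl \<longleftrightarrow> v1 \<in> set E2)"
  let ?R2 = "\<lambda>s'. unchanged_outside ?V s s' \<and> (s' ''c1'' \<noteq> Nl \<longleftrightarrow> v1 \<in> set E2) \<and> (s' ''c2'' \<noteq> Nl \<longleftrightarrow> v2 \<in> set E1)"
  have "runs (elem ''v1'' ''E2'' ''c1'') s (65 * (K * L)) ?R1"
    using assms KL bnd by (intro runs_elem) auto
  then have guards: "runs (elem ''v1'' ''E2'' ''c1'';; elem ''v2'' ''E1'' ''c2'') s (130 * (K * L) + 1) ?R2"
  proof (rule runs_seq)
    fix s1 assume s1: "?R1 s1"
    then have "runs (elem ''v2'' ''E1'' ''c2'') s1 (65 * (K * L))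
      (\<lambda>s'. unchanged_outside {''u'', ''us'', ''eq'', ''p'', ''q'', ''c2''} s1 s' \<and> (s' ''c2'' \<noteq> Nl \<longleftrightarrow> v2 \<in> set E1))"
      using assms KL bnd by (intro runs_elem) (auto simp: unchanged_outside_def)
    then show "runs (elem ''v2'' ''E1'' ''c2'') s1 (65 * (K * L)) ?R2"
      by (rule runs_mono) (use s1 in \<open>auto simp: unchanged_outside_def\<close>)
  qed simp
  have swaps: "runs ?swaps s2 (404 * B + 10) ?Q" if s2: "?R2 s2" and no: "v1 \<notin> set E2" "v2 \<notin> set E1" for s2
  proof -
    let ?S1 = "\<lambda>s'. unchanged_outside (insert ''d1'' swap_vars) s2 s' \<and> (s' ''d1'' \<noteq> Nl \<longleftrightarrow> swap_listed Es E1 v1 v2)"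
    let ?S2 = "\<lambda>s'. unchanged_outside (insert ''d1'' (insert ''d2'' swap_vars)) s2 s' \<and>
      (s' ''d1'' \<noteq> Nl \<longleftrightarrow> swap_listed Es E1 v1 v2) \<and> (s' ''d2'' \<noteq> Nl \<longleftrightarrow> swap_listed Es E2 v2 v1)"
    have "runs (swap_is_edge ''E1'' ''v1'' ''v2'' ''d1'') s2 (202 * B) ?S1"
      unfolding B_def using assms s2 by (intro runs_swap_is_edge) (auto simp: unchanged_outside_def)
    then have "runs (swap_is_edge ''E1'' ''v1'' ''v2'' ''d1'';; swap_is_edge ''E2'' ''v2'' ''v1'' ''d2'') s2
      (404 * B + 1) ?S2"
    proof (rule runs_seq)
      fix s3 assume s3: "?S1 s3"
      then have "runs (swap_is_edge ''E2'' ''v2'' ''v1'' ''d2'') s3 (202 * B)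
        (\<lambda>s'. unchanged_outside (insert ''d2'' swap_vars) s3 s' \<and> (s' ''d2'' \<noteq> Nl \<longleftrightarrow> swap_listed Es E2 v2 v1))"
        unfolding B_def using assms s2 by (intro runs_swap_is_edge) (auto simp: unchanged_outside_def)
      then show "runs (swap_is_edge ''E2'' ''v2'' ''v1'' ''d2'') s3 (202 * B) ?S2"
        by (rule runs_mono) (use s3 in \<open>auto simp: unchanged_outside_def\<close>)
    qed simp
    then show ?thesis
    proof (rule runs_seq)
      fix s4 assume "?S2 s4"
      then show "runs (IF V ''d1'' THEN SKIP ELSE IF V ''d2'' THEN SKIP ELSE ''out'' ::= yes) s4 8 ?Q"
        using s2 no by (intro runs_if_diff runs_skip runs_assign)
          (auto simp: unchanged_outside_def)
    qed simp
  qed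
  show ?thesis
    using guards
  proof (rule runs_seq)
    fix s2 assume s2: "?R2 s2"
    have off: "unchanged_outside test_vars s s2"
      by (rule unchanged_outside_mono[of ?V]) (use s2 in simp_all)
    have out: "s2 ''out'' = s ''out''"
      by (rule unchanged_outsideD[of ?V]) (use s2 in simp_all)
    show "runs (IF V ''c1'' THEN SKIP ELSE IF V ''c2'' THEN SKIP ELSE ?swaps) s2 (404 * B + 14) ?Q"
    proof (rule runs_if[where T' = "404 * B + 12"])
      assume "val (V ''c1'') s2 \<noteq> Nl"
      then show "runs SKIP s2 (404 * B + 12) ?Q"
        using s2 off out by (intro runs_skip) auto
    next
      assume c1: "val (V ''c1'') s2 = Nl"
      show "runs (IF V ''c2'' THEN SKIP ELSE ?swaps) s2 (404 * B + 12) ?Q"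
      proof (rule runs_if[where T' = "404 * B + 10"])
        assume "val (V ''c2'') s2 \<noteq> Nl"
        then show "runs SKIP s2 (404 * B + 10) ?Q"
          using s2 off out by (intro runs_skip) auto
      next
        assume "val (V ''c2'') s2 = Nl"
        then show "runs ?swaps s2 (404 * B + 10) ?Q"
          using c1 s2 by (intro swaps[OF s2]) auto
      qed simp
    qed simp
  next
    show "1 + (130 * (K * L) + 1) + (404 * B + 14) \<le> 550 * ((length Es + 1) * (K * (K * L)))"
      using \<open>K * L \<le> B\<close> \<open>1 \<le> B\<close> unfolding B_def[symmetric] by linarith
  qed
qed

lemma runs_exchange_test:
  assumes "s ''in'' = enc_list (enc_list enc_vertex) Es" and Es: "bounded_edges K L Es"
  shows "runs exchange_test s (620 * (length Es + 1) ^ 3 * (K * L) ^ 4)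
    (\<lambda>s'. s' ''out'' \<noteq> Nl \<longleftrightarrow> exchange_listed Es)"
proof -
  define m where "m = length Es + 1"
  define B where "B = m * (K * (K * L))"
  have KL: "1 \<le> K" "1 \<le> L" and bnd: "\<And>F. F \<in> set Es \<Longrightarrow> length F \<le> K"
    using Es by (auto simp: bounded_edges_def)
  have m: "length Es \<le> m" "1 \<le> m"
    by (simp_all add: m_def)
  have B1: "1 \<le> B" "1 \<le> K * B" "1 \<le> K * (K * B)" "1 \<le> m * (K * (K * B))"
    using KL m by (simp_all add: B_def)
  define good where "good E1 E2 v1 v2 \<longleftrightarrow>
    v1 \<notin> set E2 \<and> v2 \<notin> set E1 \<and> \<not> swap_listed Es E1 v1 v2 \<and> \<not> swap_listed Es E2 v2 v1" for E1 E2 v1 v2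
  let ?c = "elem ''v1'' ''E2'' ''c1'';; elem ''v2'' ''E1'' ''c2'';;
          (IF V ''c1'' THEN SKIP ELSE IF V ''c2'' THEN SKIP
           ELSE
            (swap_is_edge ''E1'' ''v1'' ''v2'' ''d1'';;
             swap_is_edge ''E2'' ''v2'' ''v1'' ''d2'';;
             (IF V ''d1'' THEN SKIP ELSE IF V ''d2'' THEN SKIP
              ELSE ''out'' ::= yes)))"
  let ?c1 = "foreach ''v2'' ''v2s'' ''E2'' ?c"
  let ?c2 = "foreach ''v1'' ''v1s'' ''E1'' ?c1"
  let ?c3 = "foreach ''E2'' ''E2s'' ''in'' ?c2"
  let ?W1 = "insert ''v2'' (insert ''v2s'' test_vars)"
  let ?W2 = "insert ''v1'' (insert ''v1s'' ?W1)"
  let ?W3 = "insert ''E2'' (insert ''E2s'' ?W2)"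
  have loop1: "runs ?c1 s (565 * (K * B)) (\<lambda>s'. unchanged_outside ?W1 s s' \<and>
      (s' ''out'' \<noteq> Nl \<longleftrightarrow> s ''out'' \<noteq> Nl \<or> (\<exists>v2 \<in> set E2. good E1 E2 v1 v2)))"
    if "s ''in'' = enc_list (enc_list enc_vertex) Es" "s ''E1'' = enc_list enc_vertex E1"
      "s ''E2'' = enc_list enc_vertex E2" "s ''v1'' = enc_vertex v1" "E1 \<in> set Es" "E2 \<in> set Es"
    for s E1 E2 v1
  proof (rule runs_foreach[where T = "550 * B" and \<phi> = "\<lambda>d. d \<noteq> Nl"])
    fix v2 s'
    assume "unchanged_outside ?W1 s s'" "s' ''v2'' = enc_vertex v2"
    then show "runs ?c s' (550 * B) (\<lambda>s''. unchanged_outside test_vars s' s'' \<and>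
      (s'' ''out'' \<noteq> Nl \<longleftrightarrow> s' ''out'' \<noteq> Nl \<or> good E1 E2 v1 v2))"
      unfolding good_def B_def m_def
      using that Es by (intro runs_pair_test) (auto simp: unchanged_outside_def)
  next
    show "5 + length E2 * (550 * B + 10) \<le> 565 * (K * B)"
      using loop_bound[OF bnd[OF that(6)] KL(1) B1(1), of 550] by simp
  qed (use that in auto)
  have loop2: "runs ?c2 s (580 * (K * (K * B))) (\<lambda>s'. unchanged_outside ?W2 s s' \<and>
      (s' ''out'' \<noteq> Nl \<longleftrightarrow> s ''out'' \<noteq> Nl \<or> (\<exists>v1 \<in> set E1. \<exists>v2 \<in> set E2. good E1 E2 v1 v2)))"
    if "s ''in'' = enc_list (enc_list enc_vertex) Es" "s ''E1'' = enc_list enc_vertex E1"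
      "s ''E2'' = enc_list enc_vertex E2" "E1 \<in> set Es" "E2 \<in> set Es"
    for s E1 E2
  proof (rule runs_foreach[where T = "565 * (K * B)" and \<phi> = "\<lambda>d. d \<noteq> Nl"])
    fix v1 s'
    assume "unchanged_outside ?W2 s s'" "s' ''v1'' = enc_vertex v1"
    then show "runs ?c1 s' (565 * (K * B)) (\<lambda>s''. unchanged_outside ?W1 s' s'' \<and>
      (s'' ''out'' \<noteq> Nl \<longleftrightarrow> s' ''out'' \<noteq> Nl \<or> (\<exists>v2 \<in> set E2. good E1 E2 v1 v2)))"
      using that by (intro loop1) (auto simp: unchanged_outside_def)
  next
    show "5 + length E1 * (565 * (K * B) + 10) \<le> 580 * (K * (K * B))"
      using loop_bound[OF bnd[OF that(4)] KL(1) B1(2), of 565] by simp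
  qed (use that in auto)
  have loop3: "runs ?c3 s (595 * (m * (K * (K * B)))) (\<lambda>s'. unchanged_outside ?W3 s s' \<and>
      (s' ''out'' \<noteq> Nl \<longleftrightarrow> s ''out'' \<noteq> Nl \<or>
        (\<exists>E2 \<in> set Es. \<exists>v1 \<in> set E1. \<exists>v2 \<in> set E2. good E1 E2 v1 v2)))"
    if "s ''in'' = enc_list (enc_list enc_vertex) Es" "s ''E1'' = enc_list enc_vertex E1" "E1 \<in> set Es"
    for s E1
  proof (rule runs_foreach[where T = "580 * (K * (K * B))" and \<phi> = "\<lambda>d. d \<noteq> Nl"])
    fix E2 s'
    assume "E2 \<in> set Es" "unchanged_outside ?W3 s s'" "s' ''E2'' = enc_list enc_vertex E2"
    then show "runs ?c2 s' (580 * (K * (K * B))) (\<lambda>s''. unchanged_outside ?W2 s' s'' \<and>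
      (s'' ''out'' \<noteq> Nl \<longleftrightarrow> s' ''out'' \<noteq> Nl \<or> (\<exists>v1 \<in> set E1. \<exists>v2 \<in> set E2. good E1 E2 v1 v2)))"
      using that by (intro loop2) (auto simp: unchanged_outside_def)
  next
    show "5 + length Es * (580 * (K * (K * B)) + 10) \<le> 595 * (m * (K * (K * B)))"
      using loop_bound[OF m B1(3), of 580] by simp
  qed (use that in auto)
  let ?s = "s(''out'' := Nl)"
  have loop4: "runs (foreach ''E1'' ''E1s'' ''in'' ?c3) ?s (610 * (m * (m * (K * (K * B)))))
    (\<lambda>s'. unchanged_outside (insert ''E1'' (insert ''E1s'' ?W3)) ?s s' \<and>
      (s' ''out'' \<noteq> Nl \<longleftrightarrow> ?s ''out'' \<noteq> Nl \<or>
        (\<exists>E1 \<in> set Es. \<exists>E2 \<in> set Es. \<exists>v1 \<in> set E1. \<exists>v2 \<in> set E2. good E1 E2 v1 v2)))"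
  proof (rule runs_foreach[where T = "595 * (m * (K * (K * B)))" and \<phi> = "\<lambda>d. d \<noteq> Nl"])
    fix E1 s'
    assume "E1 \<in> set Es" "unchanged_outside (insert ''E1'' (insert ''E1s'' ?W3)) ?s s'" "s' ''E1'' = enc_list enc_vertex E1"
    then show "runs ?c3 s' (595 * (m * (K * (K * B)))) (\<lambda>s''. unchanged_outside ?W3 s' s'' \<and>
      (s'' ''out'' \<noteq> Nl \<longleftrightarrow> s' ''out'' \<noteq> Nl \<or>
        (\<exists>E2 \<in> set Es. \<exists>v1 \<in> set E1. \<exists>v2 \<in> set E2. good E1 E2 v1 v2)))"
      using assms(1) by (intro loop3) (auto simp: unchanged_outside_def)
  next
    show "5 + length Es * (595 * (m * (K * (K * B))) + 10) \<le> 610 * (m * (m * (K * (K * B))))"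
      using loop_bound[OF m B1(4), of 595] by simp
  qed (use assms(1) in auto)
  have "1 \<le> m * (m * (K * (K * B)))"
    using mult_le_mono[OF m(2) B1(4)] by simp
  moreover have "m * (m * (K * (K * B))) \<le> m ^ 3 * (K * L) ^ 4"
  proof -
    have "m * (m * (K * (K * B))) = m ^ 3 * (K ^ 4 * L)"
      unfolding B_def by (simp add: power3_eq_cube power4_eq_xxxx mult_ac)
    also have "\<dots> \<le> m ^ 3 * (K * L) ^ 4"
      using KL(2) self_le_power[of L 4] by (simp add: power_mult_distrib)
    finally show ?thesis .
  qed
  ultimately have "2 + cost Leaf + 610 * (m * (m * (K * (K * B)))) \<le> 620 * (m ^ 3 * (K * L) ^ 4)"
    unfolding cost.simps by linarith
  then show ?thesis
    unfolding exchange_test_def exchange_listed_def m_def[symmetric] good_def[symmetric]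
    by (intro runs_init[OF loop4]) (auto simp: mult.assoc)
qed

lemma runs_negated:
  assumes "runs c s T (\<lambda>s'. s' ''out'' \<noteq> Nl \<longleftrightarrow> b)"
  shows "runs (negated c) s (T + 7) (\<lambda>s'. s' ''out'' \<noteq> Nl \<longleftrightarrow> \<not> b)"
  unfolding negated_def using assms
proof (rule runs_seq)
  fix s' :: state assume "s' ''out'' \<noteq> Nl \<longleftrightarrow> b"
  then show "runs (IF V ''out'' THEN ''out'' ::= Leaf ELSE ''out'' ::= yes) s' 6
    (\<lambda>s'. s' ''out'' \<noteq> Nl \<longleftrightarrow> \<not> b)"
    by (intro runs_if[where T' = 4] runs_assign) auto
qed simp

lemma decides_withinI:
  assumes "\<And>k X Es. (k, X, Es) \<in> I \<Longrightarrow>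
    runs c ((\<lambda>_. Nl)(''in'' := enc_list (enc_list enc_vertex) Es)) (f (k, X, Es)) (\<lambda>s'. s' ''out'' \<noteq> Nl \<longleftrightarrow> Q (k, X, Es))"
  shows "decides_within enc_inst c I Q f"
  unfolding decides_within_def
proof
  fix i assume i: "i \<in> I"
  obtain k X Es where [simp]: "i = (k, X, Es)" by (cases i)
  have "enc_inst i = enc_list (enc_list enc_vertex) Es"
    unfolding enc_inst_def enc_edges_def enc_vertex_def by simp
  then show "\<exists>t\<le>f i. answers c (enc_inst i) t (Q i)"
    using assms i unfolding runs_def answers_def by fastforce
qed


section \<open>Instances\<close>

text \<open>
  All sets involved have \<open>k\<close> elements, so a listed edge inside the exchanged set is equal
  to it. This is where the test for containment becomes a test for membership.
\<close>

lemma exchange_listed_iff: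
  assumes H: "hypergraph k X H" and Es: "edge_list Es H"
  shows "exchange_listed Es \<longleftrightarrow> exchangeable k X H"
proof -
  have H_def: "H = set ` set Es"
    using Es by (simp add: edge_list_def)
  have edge: "set E \<subseteq> X" "card (set E) = k" if "E \<in> set Es" for E
    using that H unfolding hypergraph_def nsets_def H_def by auto
  have swap: "\<not> swap_listed Es E v w \<longleftrightarrow> set E - {v} \<union> {w} \<in> non_edges k X H"
    if E: "E \<in> set Es" "v \<in> set E" "w \<notin> set E" "w \<in> X" for E v w
  proof -
    let ?S = "set E - {v} \<union> {w}"
    have card: "card ?S = k"
      using E edge(2)[OF E(1)] card_Suc_Diff1[of "set E" v] by simp
    have "swap_listed Es E v w \<longleftrightarrow> (\<exists>F \<in> set Es. set F \<subseteq> ?S)"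
      unfolding swap_listed_def by auto
    also have "\<dots> \<longleftrightarrow> (\<exists>F \<in> set Es. set F = ?S)"
      using card edge(2) by (metis card_subset_eq List.finite_set finite.emptyI finite.insertI finite_Diff finite_UnI order_refl)
    finally have "swap_listed Es E v w \<longleftrightarrow> ?S \<in> H"
      unfolding H_def by auto
    moreover have "?S \<in> nsets X k"
      using E edge(1)[OF E(1)] card by (auto simp: nsets_def)
    ultimately show ?thesis
      by (auto simp: non_edges_def)
  qed
  show ?thesis
  proof
    assume "exchange_listed Es"
    then obtain E1 E2 v1 v2 where E: "E1 \<in> set Es" "E2 \<in> set Es" "v1 \<in> set E1" "v2 \<in> set E2"
      "v1 \<notin> set E2" "v2 \<notin> set E1" "\<not> swap_listed Es E1 v1 v2" "\<not> swap_listed Es E2 v2 v1"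
      unfolding exchange_listed_def by blast
    then have "set E1 - {v1} \<union> {v2} \<in> non_edges k X H" "set E2 - {v2} \<union> {v1} \<in> non_edges k X H"
      using swap edge(1) by blast+
    with E show "exchangeable k X H"
      unfolding exchangeable_def H_def by blast
  next
    assume "exchangeable k X H"
    then obtain E1 E2 v1 v2 where E: "E1 \<in> set Es" "E2 \<in> set Es" "v1 \<in> set E1 - set E2" "v2 \<in> set E2 - set E1"
      and N: "set E1 - {v1} \<union> {v2} \<in> non_edges k X H" "set E2 - {v2} \<union> {v1} \<in> non_edges k X H"
      unfolding exchangeable_def H_def by blast
    then have "\<not> swap_listed Es E1 v1 v2" "\<not> swap_listed Es E2 v2 v1"
      using swap edge(1) by blast+
    with E show "exchange_listed Es"
      unfolding exchange_listed_def by blast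
  qed
qed

lemma instancesD:
  assumes "(k, X, Es) \<in> instances C"
  shows "hypergraph k X (set ` set Es)" "1 \<le> k" "k < card X" "edge_list Es (set ` set Es)"
    "C k X (set ` set Es)"
  using assms by (auto simp: instances_def edge_list_def)

lemma length_le_size_enc: "length xs \<le> size (enc_list e xs)"
  by (induction xs) auto

lemma size_enc_elem: "x \<in> set xs \<Longrightarrow> size (e x) \<le> size (enc_list e xs)"
  by (induction xs) auto

lemma bounded_edges_size:
  fixes Es :: "nat list list"
  defines "N \<equiv> size (enc_list (enc_list enc_vertex) Es)"
  shows "bounded_edges (N + 1) (N + 1) Es"
proof -
  have "length E \<le> N" "\<forall>v \<in> set E. length (bits v) \<le> N" if E: "E \<in> set Es" for E
  proof -
    have le: "size (enc_list enc_vertex E) \<le> N"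
      unfolding N_def using E by (rule size_enc_elem)
    then show "length E \<le> N"
      using length_le_size_enc[of E enc_vertex] by linarith
    show "\<forall>v \<in> set E. length (bits v) \<le> N"
    proof
      fix v assume "v \<in> set E"
      then have "size (enc_vertex v) \<le> size (enc_list enc_vertex E)"
        by (rule size_enc_elem)
      then show "length (bits v) \<le> N"
        using le length_le_size_enc[of "bits v" enc_bool] unfolding enc_vertex_def by linarith
    qed
  qed
  then show ?thesis
    unfolding bounded_edges_def by fastforce
qed

lemma bounded_edges_Max:
  assumes "hypergraph k X (set ` set Es)" "1 \<le> k" "k < card X" "edge_list Es (set ` set Es)"
  shows "bounded_edges k (floorlog 2 (Max X)) Es"
proof -
  have fin: "finite X"
    using assms(1) by (simp add: hypergraph_def)
  have "\<not> X \<subseteq> {0}"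
    using assms(2,3) card_mono[of "{0::nat}" X] by auto
  then obtain v where "v \<in> X" "v \<noteq> 0" by blast
  then have "0 < Max X"
    using fin Max_ge by (metis gr0I le_zero_eq)
  then have "1 \<le> floorlog 2 (Max X)"
    using floorlog_eq_zero_iff[of 2 "Max X"] by linarith
  moreover have "length E \<le> k" "\<forall>v \<in> set E. length (bits v) \<le> floorlog 2 (Max X)" if E: "E \<in> set Es" for E
  proof -
    have "set E \<in> nsets X k" "distinct E"
      using E assms(1,4) by (auto simp: hypergraph_def edge_list_def)
    then show "length E \<le> k" "\<forall>v \<in> set E. length (bits v) \<le> floorlog 2 (Max X)"
      using fin by (auto simp: nsets_def distinct_card length_bits intro!: floorlog_mono)
  qed
  ultimately show ?thesis
    using assms(2) unfolding bounded_edges_def by blast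
qed

text \<open>
  The exponent 11 comes from the three factors for the number of edges and the eight for
  \<open>(K * L) ^ 4\<close>, each of them bounded by one more than the size of the input.
\<close>

lemma decides_in_polynomial_timeI:
  assumes "\<And>k X Es. (k, X, Es) \<in> I \<Longrightarrow> exchange_listed Es \<longleftrightarrow> Q (k, X, Es)"
  shows "decides_in_polynomial_time enc_inst exchange_test I Q"
    and "decides_in_polynomial_time enc_inst (negated exchange_test) I (\<lambda>i. \<not> Q i)"
proof -
  let ?p = "smult 620 ([:1, 1:] ^ 11) :: nat poly"
  have run: "runs exchange_test ((\<lambda>_. Nl)(''in'' := enc_list (enc_list enc_vertex) Es))
      (poly ?p (size (enc_inst (k, X, Es)))) (\<lambda>s'. s' ''out'' \<noteq> Nl \<longleftrightarrow> Q (k, X, Es))"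
    if "(k, X, Es) \<in> I" for k X Es
  proof -
    let ?N = "size (enc_list (enc_list enc_vertex) Es)"
    have enc: "enc_inst (k, X, Es) = enc_list (enc_list enc_vertex) Es"
      unfolding enc_inst_def enc_edges_def enc_vertex_def by simp
    have "620 * (length Es + 1) ^ 3 * ((?N + 1) * (?N + 1)) ^ 4 \<le> 620 * (?N + 1) ^ 3 * ((?N + 1) * (?N + 1)) ^ 4"
      using length_le_size_enc by (intro mult_le_mono power_mono) auto
    also have "\<dots> = 620 * (?N + 1) ^ 11"
      by (simp only: power_mult_distrib mult.assoc flip: power_add) simp
    also have "\<dots> = poly ?p (size (enc_inst (k, X, Es)))"
      by (simp add: enc)
    finally show ?thesis
      using assms[OF that] bounded_edges_size
      by (intro runs_mono[OF runs_exchange_test]) auto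
  qed
  then show "decides_in_polynomial_time enc_inst exchange_test I Q"
    unfolding decides_in_polynomial_time_def
    by (intro exI[of _ ?p] decides_withinI)
  have "runs (negated exchange_test) ((\<lambda>_. Nl)(''in'' := enc_list (enc_list enc_vertex) Es))
      (poly (?p + [:7:]) (size (enc_inst (k, X, Es)))) (\<lambda>s'. s' ''out'' \<noteq> Nl \<longleftrightarrow> \<not> Q (k, X, Es))"
    if "(k, X, Es) \<in> I" for k X Es
    using runs_negated[OF run[OF that]] by simp
  then show "decides_in_polynomial_time enc_inst (negated exchange_test) I (\<lambda>i. \<not> Q i)"
    unfolding decides_in_polynomial_time_def
    by (intro exI[of _ "?p + [:7:]"] decides_withinI)
qed

lemma decides_in_polynomial_time_cong:
  assumes "decides_in_polynomial_time e c I Q" "\<And>i. i \<in> I \<Longrightarrow> Q i \<longleftrightarrow> Q' i"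
  shows "decides_in_polynomial_time e c I Q'"
  using assms unfolding decides_in_polynomial_time_def decides_within_def by simp

theorem mainTheorem12:
  shows
    "(\<forall>k (V :: 'a set) H. hypergraph k V H \<and> 1 \<le> k \<and> k < card V \<longrightarrow>
        card (H \<times> H) = card H ^ 2 \<and>
        (\<forall>E1 \<in> H. \<forall>E2 \<in> H. card ((E1 - E2) \<times> (E2 - E1)) \<le> k ^ 2) \<and>
        (two_monotone V H \<longleftrightarrow> \<not> exchangeable k V H))
     \<and> (\<exists>p q :: nat poly. decides_within enc_inst exchange_test all_instances (holds exchangeable)
          (\<lambda>(k, V, Es). poly p (length Es) * poly q (k * floorlog 2 (Max V))))
     \<and> decides_in_polynomial_time enc_inst exchange_test all_instances (holds exchangeable)
     \<and> decides_in_polynomial_time enc_inst (negated exchange_test) all_instances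
          (holds (\<lambda>k. two_monotone))
     \<and> (\<forall>C :: nat \<Rightarrow> nat set \<Rightarrow> nat set set \<Rightarrow> bool.
          (\<forall>k V H. hypergraph k V H \<and> 1 \<le> k \<and> k < card V \<and> C k V H \<longrightarrow>
             (equatable k V H \<longleftrightarrow> exchangeable k V H)) \<longrightarrow>
          decides_in_polynomial_time enc_inst exchange_test (instances C) (holds equatable) \<and>
          decides_in_polynomial_time enc_inst (negated exchange_test) (instances C) (holds separable))"
proof (intro conjI)
  show "\<forall>k (V :: 'a set) H. hypergraph k V H \<and> 1 \<le> k \<and> k < card V \<longrightarrow>
        card (H \<times> H) = card H ^ 2 \<and>
        (\<forall>E1 \<in> H. \<forall>E2 \<in> H. card ((E1 - E2) \<times> (E2 - E1)) \<le> k ^ 2) \<and>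
        (two_monotone V H \<longleftrightarrow> \<not> exchangeable k V H)"
  proof (intro allI impI conjI ballI)
    fix k and X :: "'a set" and H
    assume H: "hypergraph k X H \<and> 1 \<le> k \<and> k < card X"
    show "card (H \<times> H) = card H ^ 2"
      by (simp add: card_cartesian_product power2_eq_square)
    show "two_monotone X H \<longleftrightarrow> \<not> exchangeable k X H"
      using H two_monotone_iff_not_exchangeable by blast
    fix E1 E2 assume "E1 \<in> H" "E2 \<in> H"
    then have "finite E1" "finite E2" "card E1 = k" "card E2 = k"
      using H by (auto simp: hypergraph_def nsets_def)
    then have "card (E1 - E2) \<le> k" "card (E2 - E1) \<le> k"
      by (metis Diff_subset card_mono)+
    then show "card ((E1 - E2) \<times> (E2 - E1)) \<le> k ^ 2"
      by (simp add: card_cartesian_product power2_eq_square mult_le_mono)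
  qed
next
  have "decides_within enc_inst exchange_test all_instances (holds exchangeable)
      (\<lambda>(k, V, Es). poly (smult 620 ([:1, 1:] ^ 3)) (length Es) * poly (monom 1 4) (k * floorlog 2 (Max V)))"
  proof (rule decides_withinI)
    fix k X Es assume i: "(k, X, Es) \<in> all_instances"
    note D = instancesD[OF i]
    have "exchange_listed Es \<longleftrightarrow> holds exchangeable (k, X, Es)"
      using exchange_listed_iff[OF D(1,4)] by (simp add: holds_def)
    then show "runs exchange_test ((\<lambda>_. Nl)(''in'' := enc_list (enc_list enc_vertex) Es))
      ((\<lambda>(k, V, Es). poly (smult 620 ([:1, 1:] ^ 3)) (length Es) * poly (monom 1 4) (k * floorlog 2 (Max V))) (k, X, Es))
      (\<lambda>s'. s' ''out'' \<noteq> Nl \<longleftrightarrow> holds exchangeable (k, X, Es))"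
      using bounded_edges_Max[OF D(1-4)]
      by (intro runs_mono[OF runs_exchange_test]) (auto simp: poly_monom)
  qed
  then show "\<exists>p q :: nat poly. decides_within enc_inst exchange_test all_instances (holds exchangeable)
          (\<lambda>(k, V, Es). poly p (length Es) * poly q (k * floorlog 2 (Max V)))"
    by blast
next
  have iff: "exchange_listed Es \<longleftrightarrow> holds exchangeable (k, X, Es)"
    if "(k, X, Es) \<in> instances C" for k X Es C
    using exchange_listed_iff[OF instancesD(1,4)[OF that]] by (simp add: holds_def)
  show "decides_in_polynomial_time enc_inst exchange_test all_instances (holds exchangeable)"
    using iff by (rule decides_in_polynomial_timeI)
  have "\<not> holds exchangeable i \<longleftrightarrow> holds (\<lambda>k. two_monotone) i" if "i \<in> all_instances" for i
    using that by (cases i) (simp add: holds_def two_monotone_iff_not_exchangeable[OF instancesD(1)])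
  with decides_in_polynomial_timeI(2)[of all_instances, OF iff]
  show "decides_in_polynomial_time enc_inst (negated exchange_test) all_instances (holds (\<lambda>k. two_monotone))"
    by (rule decides_in_polynomial_time_cong)
  show "\<forall>C :: nat \<Rightarrow> nat set \<Rightarrow> nat set set \<Rightarrow> bool.
          (\<forall>k V H. hypergraph k V H \<and> 1 \<le> k \<and> k < card V \<and> C k V H \<longrightarrow>
             (equatable k V H \<longleftrightarrow> exchangeable k V H)) \<longrightarrow>
          decides_in_polynomial_time enc_inst exchange_test (instances C) (holds equatable) \<and>
          decides_in_polynomial_time enc_inst (negated exchange_test) (instances C) (holds separable)"
  proof (intro allI impI conjI)
    fix C :: "nat \<Rightarrow> nat set \<Rightarrow> nat set set \<Rightarrow> bool"
    assume C: "\<forall>k V H. hypergraph k V H \<and> 1 \<le> k \<and> k < card V \<and> C k V H \<longrightarrow>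
             (equatable k V H \<longleftrightarrow> exchangeable k V H)"
    have eq: "holds exchangeable i \<longleftrightarrow> holds equatable i"
      and sep: "\<not> holds exchangeable i \<longleftrightarrow> holds separable i" if "i \<in> instances C" for i
    proof -
      obtain k X Es where i: "i = (k, X, Es)"
        by (cases i)
      then have mem: "(k, X, Es) \<in> instances C"
        using that by simp
      note D = instancesD[OF mem]
      have "equatable k X (set ` set Es) \<longleftrightarrow> exchangeable k X (set ` set Es)"
        using C D(1,2,3,5) by blast
      then show "holds exchangeable i \<longleftrightarrow> holds equatable i" "\<not> holds exchangeable i \<longleftrightarrow> holds separable i"
        using separable_iff_not_equatable[OF D(1,2)] by (simp_all add: holds_def i)
    qed
    from decides_in_polynomial_timeI(1)[of "instances C", OF iff] eq
    show "decides_in_polynomial_time enc_inst exchange_test (instances C) (holds equatable)"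
      by (rule decides_in_polynomial_time_cong)
    from decides_in_polynomial_timeI(2)[of "instances C", OF iff] sep
    show "decides_in_polynomial_time enc_inst (negated exchange_test) (instances C) (holds separable)"
      by (rule decides_in_polynomial_time_cong)
  qed
qed

end
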